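(* Let $0<\alpha<1$, let $A$ be a closed linear operator on a Banach space $X$, and suppose that $A$ generates the $(\alpha,\alpha)$-resolvent family $\{S_{\alpha,\alpha}(t)\}_{t\ge 0}$. Let $x\in X$ and $T>0$, and let $u(t;x)=S_{\alpha,\alpha}(t)x$ be the solution of ${}^R\partial_t^\alpha u(t)=Au(t)$, $t>0$, $(g_{1-\alpha}\ast u)(0)=x$ (Riemann-Liouville derivative). Then the order $\alpha$ satisfies $$Tu(T;x)=\alpha\,G_T(x),$$ where $G_t(x):=A(g_1\ast S_{\alpha,\alpha}\ast S_{\alpha,\alpha})(t)x+(g_1\ast S_{\alpha,\alpha})(t)x$.
   Context: Conventions. For $\gamma>0$, $g_\gamma(t):=t^{\gamma-1}/\Gamma(\gamma)$ (so $g_1\equiv 1$). The finite convolution is $(f\ast g)(t):=\int_0^t f(t-s)g(s)\,ds$, used also for operator-valued functions (pointwise on vectors $x\in X$). For $0<\alpha<1$ the Riemann-Liouville derivative is ${}^R\partial_t^\alpha f(t)=\frac{d}{dt}\int_0^t g_{1-\alpha}(t-s)f(s)\,ds$. Resolvent families. Let $A$ be a closed linear operator on a Banach space $X$ and $\alpha,\beta>0$. $A$ is the generator of an $(\alpha,\beta)$-resolvent family if there exist $\omega\ge 0$ and a strongly continuous function $S_{\alpha,\beta}:(0,\infty)\to\mathcal{B}(X)$ (bounded linear operators on $X$) that is exponentially bounded (there are $M>0$, $w\in\mathbb{R}$ with $\|S_{\alpha,\beta}(t)\|\le Me^{wt}$ for $t>0$), with $\{\lambda^\alpha:\mathrm{Re}\,\lambda>\omega\}\subset\rho(A)$,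 such that for all $x\in X$ and $\mathrm{Re}\,\lambda>\omega$, $\lambda^{\alpha-\beta}(\lambda^\alpha-A)^{-1}x=\int_0^\infty e^{-\lambda t}S_{\alpha,\beta}(t)x\,dt$. Then $\{S_{\alpha,\beta}(t)\}$ is called the $(\alpha,\beta)$-resolvent family generated by $A$. *)

theory Defs
  imports "HOL-Analysis.Analysis"
begin

text \<open>
  The class \<open>banach\<close> is real; the Laplace variable and the spectral parameter are complex,
  so the scalar action is extended to the complex numbers.
\<close>

class complex_banach = banach +
  fixes scaleC :: "complex \<Rightarrow> 'a \<Rightarrow> 'a"  (infixr "*\<^sub>C" 75)
  assumes scaleC_add_right: "a *\<^sub>C (x + y) = a *\<^sub>C x + a *\<^sub>C y"
    and scaleC_add_left: "(a + b) *\<^sub>C x = a *\<^sub>C x + b *\<^sub>C x"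
    and scaleC_scaleC: "a *\<^sub>C b *\<^sub>C x = (a * b) *\<^sub>C x"
    and scaleC_of_real: "complex_of_real r *\<^sub>C x = r *\<^sub>R x"
    and norm_scaleC: "norm (a *\<^sub>C x) = cmod a * norm x"

definition bounded_clinear :: "('a::complex_banach \<Rightarrow> 'a) \<Rightarrow> bool" where
  "bounded_clinear f \<longleftrightarrow> bounded_linear f \<and> (\<forall>c x. f (c *\<^sub>C x) = c *\<^sub>C f x)"

text \<open>
  An unbounded operator is given by its domain \<open>D\<close> together with a function \<open>A\<close> whose values
  outside \<open>D\<close> are irrelevant.
\<close>

definition closed_operator :: "'a::complex_banach set \<Rightarrow> ('a \<Rightarrow> 'a) \<Rightarrow> bool" where
  "closed_operator D A \<longleftrightarrow>
     0 \<in> D \<and>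
     (\<forall>x\<in>D. \<forall>y\<in>D. x + y \<in> D \<and> A (x + y) = A x + A y) \<and>
     (\<forall>c. \<forall>x\<in>D. c *\<^sub>C x \<in> D \<and> A (c *\<^sub>C x) = c *\<^sub>C A x) \<and>
     closed ((\<lambda>x. (x, A x)) ` D)"

definition resolvent :: "'a::complex_banach set \<Rightarrow> ('a \<Rightarrow> 'a) \<Rightarrow> complex \<Rightarrow> 'a \<Rightarrow> 'a" where
  "resolvent D A \<mu> = inv_into D (\<lambda>y. \<mu> *\<^sub>C y - A y)"

definition resolvent_set :: "'a::complex_banach set \<Rightarrow> ('a \<Rightarrow> 'a) \<Rightarrow> complex set" where
  "resolvent_set D A =
     {\<mu>. bij_betw (\<lambda>y. \<mu> *\<^sub>C y - A y) D UNIV \<and> bounded_clinear (resolvent D A \<mu>)}"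

text \<open>
  Integrals are Henstock-Kurzweil integrals, since the Bochner integral of the library is
  confined to second countable (hence separable) spaces. The value of a family at \<open>t = 0\<close> never
  matters.

  On the exponential bound: for \<open>\<beta> \<ge> 1\<close> it is equivalent to
  \<open>onorm (S t) \<le> M * exp (w * t)\<close> for all \<open>t > 0\<close>. For \<open>\<beta> < 1\<close> it is weaker, admitting the
  singularity \<open>t powr (\<beta> - 1)\<close> at the origin. With the bound \<open>M * exp (w * t)\<close> down to \<open>t = 0\<close>,
  an \<open>(\<alpha>, \<alpha>)\<close>-resolvent family with \<open>\<alpha> < 1\<close> would exist only on the zero space; already
  \<open>A = 0\<close> has \<open>S t x = (t powr (\<alpha> - 1) / Gamma \<alpha>) *\<^sub>R x\<close>.
\<close>

definition resolvent_family ::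
    "real \<Rightarrow> real \<Rightarrow> 'a::complex_banach set \<Rightarrow> ('a \<Rightarrow> 'a) \<Rightarrow> (real \<Rightarrow> 'a \<Rightarrow> 'a) \<Rightarrow> bool" where
  "resolvent_family \<alpha> \<beta> D A S \<longleftrightarrow>
     (\<forall>t>0. bounded_clinear (S t)) \<and>
     (\<forall>x. continuous_on {0<..} (\<lambda>t. S t x)) \<and>
     (\<exists>M>0. \<exists>w. \<forall>t>0. onorm (S t) \<le> M * max 1 (t powr (\<beta> - 1)) * exp (w * t)) \<and>
     (\<exists>\<omega>\<ge>0.
        {z powr complex_of_real \<alpha> | z. Re z > \<omega>} \<subseteq> resolvent_set D A \<and>
        (\<forall>x z. Re z > \<omega> \<longrightarrow>
           ((\<lambda>t. exp (- z * complex_of_real t) *\<^sub>C S t x) has_integral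
            (z powr complex_of_real (\<alpha> - \<beta>)) *\<^sub>C
              resolvent D A (z powr complex_of_real \<alpha>) x) {0..}))"

text \<open>
  Meant for \<open>t > 0\<close>: as \<open>0 powr 0 = 0\<close>, \<open>gker 1\<close> is \<open>1\<close> except at the origin, which
  does not affect integrals.
\<close>

definition gker :: "real \<Rightarrow> real \<Rightarrow> real" where
  "gker \<gamma> t = t powr (\<gamma> - 1) / Gamma \<gamma>"

text \<open>
  Finite convolution of operator-valued functions, pointwise on vectors. A scalar kernel \<open>k\<close>
  is entered as the operator-valued function \<open>\<lambda>t. scaleR (k t)\<close>.
\<close>

definition op_conv ::
    "(real \<Rightarrow> 'a \<Rightarrow> 'a) \<Rightarrow> (real \<Rightarrow> 'a \<Rightarrow> 'a) \<Rightarrow> real \<Rightarrow> 'a \<Rightarrow> 'a::real_normed_vector"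
    (infixr "\<star>" 70) where
  "(F \<star> H) t x = integral {0..t} (\<lambda>s. F (t - s) (H s x))"

abbreviation g1 :: "real \<Rightarrow> 'a \<Rightarrow> 'a::real_normed_vector" where
  "g1 \<equiv> \<lambda>t. scaleR (gker 1 t)"

definition G :: "('a \<Rightarrow> 'a) \<Rightarrow> (real \<Rightarrow> 'a \<Rightarrow> 'a) \<Rightarrow> real \<Rightarrow> 'a \<Rightarrow> 'a::complex_banach" where
  "G A S t x = A ((g1 \<star> S \<star> S) t x) + (g1 \<star> S) t x"

end

theory Submission
  imports Defs "HOL-Real_Asymp.Real_Asymp"
begin

text \<open>
  On the Laplace side, \<open>S\<close> becomes the resolvent \<open>R (l powr \<alpha>)\<close> and multiplication by \<open>t\<close> becomes
  \<open>- d / dl\<close>, which gives \<open>\<alpha> * l powr (\<alpha> - 1)\<close> times the squared resolvent; since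
  \<open>A R + I = l powr \<alpha> R\<close>, the transform of \<open>\<alpha> G\<close> is the same. Real \<open>l\<close> suffice for uniqueness.

  Everything is tested against bounded real functionals, so that Fubini and dominated
  convergence are needed for scalar functions only. Membership in the domain is obtained without
  transforming \<open>A\<close>: with \<open>y = (g1 \<star> S \<star> S) T x\<close> and \<open>z\<close> the claimed value of \<open>A y\<close>, it is equivalent to
  the identity \<open>y = R \<mu> (\<mu> y - z)\<close>, which involves bounded operators only, for one \<open>\<mu>\<close> in the resolvent set.
\<close>

subsection \<open>Separation by bounded functionals\<close>

text \<open>The shape of \<open>G\<close> is read off from
  \<open>l powr (\<alpha> - 1) = l powr \<alpha> / l\<close>. The quotient by \<open>l\<close> is
  the transform of \<open>g1\<close>, and \<open>l powr \<alpha>\<close> times the squared resolvent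
  is \<open>(A R + I) R\<close>, that is, \<open>A (S \<star> S) + S\<close> on the Laplace side.
  The factor \<alpha> is left over from differentiating \<open>l powr \<alpha>\<close>. Nothing says
  beforehand that the values of \<open>S \<star> S\<close> lie in \<open>D\<close>, so
  \<open>A\<close> is not carried under an integral. A resolvent at a fixed point \<open>m\<close>
  is applied instead: on the domain, \<open>Rs m\<close> after \<open>A\<close> is
  \<open>m powr \<alpha>\<close> times \<open>Rs m\<close>, minus the identity. What remains
  compares scalar functions that are continuous for positive times, so equal transforms give
  equality at \<open>T\<close> itself and not merely almost everywhere. The analytic obstacle is the
  origin, where \<open>S t\<close> may grow like \<open>t powr (\<alpha> - 1)\<close> and
  \<open>S \<star> S\<close> like \<open>t powr (2 * \<alpha> - 1)\<close>. Hence the integration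
  lemmas ask for continuity and domination only inside an open interval.\<close>

definition sublinear :: "('a::real_vector \<Rightarrow> real) \<Rightarrow> bool" where
  "sublinear p \<longleftrightarrow> p 0 = 0 \<and> (\<forall>x y. p (x + y) \<le> p x + p y) \<and> (\<forall>c>0. \<forall>x. p (c *\<^sub>R x) \<le> c * p x)"

text \<open>The definition asks only for an inequality, which is easier to verify; scaling back by
  \<open>1 / c\<close> gives the other half.\<close>

lemma sublinear_scaleR:
  assumes "sublinear p" "c \<ge> 0"
  shows "p (c *\<^sub>R x) = c * p x"
proof (cases "c = 0")
  case False
  then have c: "c > 0" using assms by simp
  have "p ((1 / c) *\<^sub>R c *\<^sub>R x) \<le> (1 / c) * p (c *\<^sub>R x)"
    using assms(1) c unfolding sublinear_def by (metis zero_less_divide_1_iff)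
  then have "c * p x \<le> p (c *\<^sub>R x)" using c by (simp add: field_simps)
  moreover have "p (c *\<^sub>R x) \<le> c * p x" using assms(1) c unfolding sublinear_def by blast
  ultimately show ?thesis by linarith
qed (use assms in \<open>auto simp: sublinear_def\<close>)

lemma sublinear_lower:
  assumes "sublinear p"
  shows "- p (- x) \<le> p x"
proof -
  have "p (x + - x) \<le> p x + p (- x)" "p 0 = 0"
    using assms unfolding sublinear_def by blast+
  then show ?thesis by simp
qed

text \<open>The classical lowering step of Hahn-Banach. Taking \<open>t = 0\<close> shows that it
  lies below \<open>p\<close>, and \<open>t = 1\<close> at \<open>- a\<close> gives a value of at
  most \<open>- p a\<close>, so the new functional is odd on \<open>a\<close>.\<close>

definition linearize_at :: "'a::real_vector \<Rightarrow> ('a \<Rightarrow> real) \<Rightarrow> 'a \<Rightarrow> real" where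
  "linearize_at a p x = (INF t\<in>{0..}. p (x + t *\<^sub>R a) - t * p a)"

text \<open>This bound does not depend on \<open>t\<close>, so the infimum defining
  \<open>linearize_at\<close> is finite.\<close>

lemma linearize_at_lower:
  assumes "sublinear p" "t \<ge> 0"
  shows "- p (- x) \<le> p (x + t *\<^sub>R a) - t * p a"
proof -
  have "p (- x + (x + t *\<^sub>R a)) \<le> p (- x) + p (x + t *\<^sub>R a)"
    using assms unfolding sublinear_def by blast
  then show ?thesis using sublinear_scaleR[OF assms, of a] by simp
qed

lemma linearize_at_le:
  assumes "sublinear p" "t \<ge> 0"
  shows "linearize_at a p x \<le> p (x + t *\<^sub>R a) - t * p a"
  unfolding linearize_at_def
  by (rule cINF_lower[OF bdd_belowI2]) (use assms linearize_at_lower in auto)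

lemma linearize_at_greatest:
  assumes "\<And>t. t \<ge> 0 \<Longrightarrow> m \<le> p (x + t *\<^sub>R a) - t * p a"
  shows "m \<le> linearize_at a p x"
  unfolding linearize_at_def by (rule cINF_greatest) (use assms in auto)

lemma sublinear_linearize_at:
  assumes p: "sublinear p"
  shows "sublinear (linearize_at a p)"
  unfolding sublinear_def
proof (intro conjI allI impI)
  have "p 0 = 0" using p unfolding sublinear_def by blast
  then show "linearize_at a p 0 = 0"
    using linearize_at_le[OF p, of 0 a 0] sublinear_scaleR[OF p, of _ a]
    by (intro antisym linearize_at_greatest) auto
next
  fix x y
  have "linearize_at a p (x + y) - (p (y + s *\<^sub>R a) - s * p a) \<le> p (x + t *\<^sub>R a) - t * p a"
    if "s \<ge> 0" "t \<ge> 0" for s t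
  proof -
    have "linearize_at a p (x + y) \<le> p ((x + y) + (s + t) *\<^sub>R a) - (s + t) * p a"
      using that by (intro linearize_at_le[OF p]) auto
    moreover have "p ((x + t *\<^sub>R a) + (y + s *\<^sub>R a)) \<le> p (x + t *\<^sub>R a) + p (y + s *\<^sub>R a)"
      using p unfolding sublinear_def by blast
    ultimately show ?thesis by (simp add: algebra_simps)
  qed
  then have "linearize_at a p (x + y) - (p (y + s *\<^sub>R a) - s * p a) \<le> linearize_at a p x"
    if "s \<ge> 0" for s
    using that by (intro linearize_at_greatest)
  then have "linearize_at a p (x + y) - linearize_at a p x \<le> linearize_at a p y"
    by (intro linearize_at_greatest) (simp add: algebra_simps)
  then show "linearize_at a p (x + y) \<le> linearize_at a p x + linearize_at a p y" by simp
next
  fix c :: real and x assume c: "c > 0"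
  have "linearize_at a p (c *\<^sub>R x) / c \<le> p (x + t *\<^sub>R a) - t * p a" if "t \<ge> 0" for t
  proof -
    have "linearize_at a p (c *\<^sub>R x) \<le> p (c *\<^sub>R x + (c * t) *\<^sub>R a) - (c * t) * p a"
      using that c by (intro linearize_at_le[OF p]) auto
    also have "p (c *\<^sub>R x + (c * t) *\<^sub>R a) = c * p (x + t *\<^sub>R a)"
      using sublinear_scaleR[OF p, of c "x + t *\<^sub>R a"] c by (simp add: scaleR_add_right)
    finally show ?thesis using c by (simp add: field_simps)
  qed
  then have "linearize_at a p (c *\<^sub>R x) / c \<le> linearize_at a p x"
    by (rule linearize_at_greatest)
  then show "linearize_at a p (c *\<^sub>R x) \<le> c * linearize_at a p x"
    using c by (simp add: field_simps)
qed

text \<open>Zorn for the reversed pointwise order: a chain is bounded by its pointwise infimum,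
  which is finite because every member of the chain is at least \<open>- p (- x)\<close> at
  \<open>x\<close>.\<close>

lemma exists_minimal_sublinear:
  fixes p :: "'a::real_vector \<Rightarrow> real"
  assumes p: "sublinear p"
  obtains q where "sublinear q" "q \<le> p" "\<And>r. sublinear r \<Longrightarrow> r \<le> q \<Longrightarrow> r = q"
proof -
  define Q where "Q = {q. sublinear q \<and> q \<le> p}"
  have "\<exists>m\<in>Q. \<forall>a\<in>Q. a \<le> m \<longrightarrow> a = m"
  proof (rule predicate_Zorn)
    show "partial_order_on Q (relation_of (\<lambda>a b. b \<le> a) Q)"
      by (rule partial_order_on_relation_ofI) auto
  next
    fix C assume "C \<in> Chains (relation_of (\<lambda>a b. b \<le> a) Q)"
    then have CQ: "C \<subseteq> Q" and ch: "\<And>q r. q \<in> C \<Longrightarrow> r \<in> C \<Longrightarrow> q \<le> r \<or> r \<le> q"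
      by (auto simp: Chains_def relation_of_def)
    show "\<exists>u\<in>Q. \<forall>a\<in>C. u \<le> a"
    proof (cases "C = {}")
      case True
      then show ?thesis using p by (auto simp: Q_def)
    next
      case False
      define u where "u = (\<lambda>x. INF q\<in>C. q x)"
      have sub: "sublinear q" "q \<le> p" if "q \<in> C" for q using that CQ by (auto simp: Q_def)
      have low: "- p (- x) \<le> q x" if "q \<in> C" for q x
        using sublinear_lower[OF sub(1)[OF that], of x] sub(2)[OF that]
        by (meson le_funD neg_le_iff_le order_trans)
      have u_le: "u x \<le> q x" if "q \<in> C" for q x
        unfolding u_def by (rule cINF_lower[OF bdd_belowI2]) (use that low in auto)
      have u_ge: "m \<le> u x" if "\<And>q. q \<in> C \<Longrightarrow> m \<le> q x" for m x
        unfolding u_def by (rule cINF_greatest) (use that False in auto)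
      have "sublinear u"
        unfolding sublinear_def
      proof (intro conjI allI impI)
        have "q 0 = 0" if "q \<in> C" for q using sub(1)[OF that] unfolding sublinear_def by blast
        moreover obtain q where "q \<in> C" using False by blast
        ultimately show "u 0 = 0" using u_le[of q 0] u_ge[of 0 0] by force
      next
        fix x y
        have "u (x + y) - q x \<le> r y" if "q \<in> C" "r \<in> C" for q r
        proof -
          \<comment> \<open>In a chain the smaller of \<open>q\<close> and \<open>r\<close> serves
            at both points, so the separate infima over \<open>q\<close> and \<open>r\<close> cost
            nothing.\<close>
          obtain s where s: "s \<in> C" "s \<le> q" "s \<le> r" using ch[OF \<open>q \<in> C\<close> \<open>r \<in> C\<close>] \<open>q \<in> C\<close> \<open>r \<in> C\<close>
            by (meson order_refl)
          have "u (x + y) \<le> s (x + y)" using u_le s by blast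
          also have "\<dots> \<le> s x + s y" using sub(1)[OF s(1)] unfolding sublinear_def by blast
          also have "\<dots> \<le> q x + r y" using s by (intro add_mono) (auto simp: le_fun_def)
          finally show ?thesis by simp
        qed
        then have "u (x + y) - q x \<le> u y" if "q \<in> C" for q using that by (intro u_ge)
        then have "u (x + y) - u y \<le> u x" by (intro u_ge) (simp add: algebra_simps)
        then show "u (x + y) \<le> u x + u y" by simp
      next
        fix c :: real and x assume c: "c > 0"
        have "u (c *\<^sub>R x) / c \<le> q x" if "q \<in> C" for q
          using u_le[OF that, of "c *\<^sub>R x"] sublinear_scaleR[OF sub(1)[OF that], of c x] c
          by (simp add: field_simps)
        then have "u (c *\<^sub>R x) / c \<le> u x" by (rule u_ge)
        then show "u (c *\<^sub>R x) \<le> c * u x" using c by (simp add: field_simps)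
      qed
      moreover have "u \<le> p"
        using False u_le sub(2) by (meson ex_in_conv le_funD le_funI order_trans)
      ultimately show ?thesis using u_le by (auto simp: Q_def le_fun_def)
    qed
  qed
  then show thesis using that unfolding Q_def by (blast intro: order_trans)
qed

text \<open>
  A minimal sublinear functional \<open>q\<close> is linear: it equals its linearization at every \<open>a\<close>,
  which forces \<open>q (- a) \<le> - q a\<close>.
\<close>

lemma separating_functional:
  fixes y :: "'a::real_normed_vector"
  assumes "y \<noteq> 0"
  obtains \<phi> :: "'a \<Rightarrow> real" where "bounded_linear \<phi>" "\<phi> y \<noteq> 0"
proof -
  have norm_sub: "sublinear (norm :: 'a \<Rightarrow> real)"
    unfolding sublinear_def by (auto intro: norm_triangle_ineq)
  \<comment> \<open>The search starts below \<open>linearize_at y norm\<close> rather than below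
    \<open>norm\<close>: this forces \<open>q (- y) \<le> - norm y\<close>, so that \<open>q\<close>
    cannot vanish at \<open>y\<close>.\<close>
  obtain q where q: "sublinear q" "q \<le> linearize_at y norm"
      and min: "\<And>r. sublinear r \<Longrightarrow> r \<le> q \<Longrightarrow> r = q"
    using exists_minimal_sublinear[OF sublinear_linearize_at[OF norm_sub]] by blast
  have q_norm: "q x \<le> norm x" for x
    using linearize_at_le[OF norm_sub, of 0 y x] q(2) by (auto simp: le_fun_def intro: order_trans)
  have lin: "linearize_at a q = q" for a
    using linearize_at_le[OF q(1), of 0 a]
    by (intro min sublinear_linearize_at q) (auto simp: le_fun_def)
  have neg: "q (- a) = - q a" for a
  proof -
    have "q (- a) \<le> q (- a + 1 *\<^sub>R a) - 1 * q a"
      using linearize_at_le[OF q(1), of 1 a "- a"] unfolding lin by simp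
    moreover have "q 0 = 0" using q(1) unfolding sublinear_def by blast
    ultimately show ?thesis using sublinear_lower[OF q(1), of a] by simp
  qed
  have "bounded_linear q"
  proof (rule bounded_linear_intro[where K = 1])
    fix x z
    have sa: "\<And>x y. q (x + y) \<le> q x + q y" using q(1) unfolding sublinear_def by blast
    show "q (x + z) = q x + q z"
      using sa[of x z] sa[of "- x" "- z"] neg[of "x + z"] neg[of x] neg[of z] by simp
    show "norm (q x) \<le> norm x * 1"
      using q_norm[of x] q_norm[of "- x"] neg[of x] by simp
    fix c :: real
    show "q (c *\<^sub>R x) = c *\<^sub>R q x"
      using sublinear_scaleR[OF q(1), of c x] sublinear_scaleR[OF q(1), of "- c" x]
        neg[of "c *\<^sub>R x"]
      by (cases "c \<ge> 0") auto
  qed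
  moreover have "q (- y) \<le> - norm y"
    using linearize_at_le[OF norm_sub, of 1 y "- y"] q(2)
    by (auto simp: le_fun_def intro: order_trans)
  then have "q y \<noteq> 0" using assms neg[of y] by auto
  ultimately show thesis by (rule that)
qed

subsection \<open>Integrals of Banach-valued functions with integrable singularities\<close>

text \<open>The increments of an antiderivative of \<open>f\<close> are bounded by those of the
  integral of \<open>g\<close>, which is uniformly continuous on the closed interval. The
  antiderivative therefore extends continuously to the endpoints, and the fundamental theorem with
  interior derivatives applies.\<close>

lemma integrable_on_dominated_open:
  fixes f :: "real \<Rightarrow> 'a::banach"
  assumes cont: "continuous_on {a<..<b} f"
    and g: "g integrable_on {a..b}"
    and le: "\<And>t. a < t \<Longrightarrow> t < b \<Longrightarrow> norm (f t) \<le> g t"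
  shows "f integrable_on {a..b}"
proof (cases "a < b")
  case True
  define c where "c = (a + b) / 2"
  have c: "a < c" "c < b" using True by (auto simp: c_def)
  \<comment> \<open>The oriented integral starts at the midpoint, since integrability up to
    \<open>a\<close> is what has to be shown.\<close>
  define F where "F t = (if c \<le> t then integral {c..t} f else - integral {t..c} f)" for t
  define \<Gamma> where "\<Gamma> t = integral {a..t} g" for t
  have int: "f integrable_on {s..t}" if "a < s" "t < b" for s t
    by (rule integrable_continuous_interval, rule continuous_on_subset[OF cont]) (use that in auto)
  have gint: "g integrable_on {s..t}" if "a \<le> s" "t \<le> b" for s t
    by (rule integrable_on_subinterval[OF g]) (use that in auto)
  have F_diff: "F t - F s = integral {s..t} f" if "a < s" "s \<le> t" "t < b" for s t
  proof -
    consider "c \<le> s" | "s < c" "c \<le> t" | "t < c" by linarith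
    then show ?thesis
    proof cases
      case 1
      then show ?thesis
        using Henstock_Kurzweil_Integration.integral_combine[of c s t f] that int[of c t] c by (auto simp: F_def algebra_simps)
    next
      case 2
      then show ?thesis
        using Henstock_Kurzweil_Integration.integral_combine[of s c t f] that int[of s t] c by (auto simp: F_def algebra_simps)
    next
      case 3
      then show ?thesis
        using Henstock_Kurzweil_Integration.integral_combine[of s t c f] that int[of s c] c by (auto simp: F_def algebra_simps)
    qed
  qed
  have F_le: "norm (F t - F s) \<le> \<Gamma> t - \<Gamma> s" if "a < s" "s \<le> t" "t < b" for s t
  proof -
    have "norm (integral {s..t} f) \<le> integral {s..t} g"
      by (rule integral_norm_bound_integral) (use that int gint le in auto)
    also have "\<dots> = \<Gamma> t - \<Gamma> s"
      using Henstock_Kurzweil_Integration.integral_combine[of a s t g] that gint[of a t] by (simp add: \<Gamma>_def)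
    finally show ?thesis using F_diff that by simp
  qed
  have "continuous_on {a..b} \<Gamma>"
    unfolding \<Gamma>_def by (rule indefinite_integral_continuous_1[OF g])
  then have uc: "uniformly_continuous_on {a..b} \<Gamma>"
    by (intro compact_uniformly_continuous) auto
  have "uniformly_continuous_on {a<..<b} F"
    unfolding uniformly_continuous_on_def
  proof (intro allI impI)
    fix e :: real assume "e > 0"
    then obtain d where d: "d > 0"
      "\<And>x y. x \<in> {a..b} \<Longrightarrow> y \<in> {a..b} \<Longrightarrow> dist y x < d \<Longrightarrow> dist (\<Gamma> y) (\<Gamma> x) < e"
      using uc unfolding uniformly_continuous_on_def by metis
    have "dist (F y) (F x) < e" if xy: "x \<in> {a<..<b}" "y \<in> {a<..<b}" "dist y x < d" for x y
    proof (cases "x \<le> y")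
      case True
      then show ?thesis using F_le[of x y] d(2)[of x y] xy by (auto simp: dist_norm)
    next
      case False
      then show ?thesis using F_le[of y x] d(2)[of y x] xy
        by (auto simp: dist_norm norm_minus_commute)
    qed
    then show "\<exists>d>0. \<forall>x\<in>{a<..<b}. \<forall>y\<in>{a<..<b}. dist y x < d \<longrightarrow> dist (F y) (F x) < e"
      using d(1) by blast
  qed
  then obtain H where H: "uniformly_continuous_on (closure {a<..<b}) H"
      "\<And>x. x \<in> {a<..<b} \<Longrightarrow> F x = H x"
    using uniformly_continuous_on_extension_on_closure by metis
  have cl: "closure {a<..<b} = {a..b}" using True by simp
  have "(f has_integral H b - H a) {a..b}"
  proof (rule fundamental_theorem_of_calculus_interior)
    show "continuous_on {a..b} H" using H(1) cl uniformly_continuous_imp_continuous by metis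
    fix t assume t: "t \<in> {a<..<b}"
    define s1 where "s1 = (a + t) / 2"
    define s2 where "s2 = (t + b) / 2"
    have s: "a < s1" "s1 < t" "t < s2" "s2 < b" using t by (auto simp: s1_def s2_def)
    have "((\<lambda>u. integral {s1..u} f) has_vector_derivative f t) (at t within {s1..s2})"
      by (rule integral_has_vector_derivative)
         (use s in \<open>auto intro: continuous_on_subset[OF cont]\<close>)
    then have "((\<lambda>u. integral {s1..u} f) has_vector_derivative f t) (at t)"
      using s by (simp add: at_within_Icc_at)
    then have "((\<lambda>u. F s1 + integral {s1..u} f) has_vector_derivative f t) (at t)"
      by (auto intro!: derivative_eq_intros)
    then show "(H has_vector_derivative f t) (at t)"
    proof (rule has_vector_derivative_transform_within_open[where S = "{s1<..<s2}"])
      fix u assume u: "u \<in> {s1<..<s2}"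
      then have "F u - F s1 = integral {s1..u} f" using F_diff s by auto
      then show "F s1 + integral {s1..u} f = H u" using H(2)[of u] u s by (simp add: algebra_simps)
    qed (use s in auto)
  qed (use True in auto)
  then show ?thesis by blast
next
  case False
  then have "negligible {a..b}" by (cases "a = b") auto
  then show ?thesis by (rule integrable_negligible)
qed

text \<open>Cutting off both ends leaves integrals that are continuous in \<open>t\<close>; the
  error is at most the mass of \<open>g\<close> near 0 and 1, which is independent of
  \<open>t\<close>, so the limit is uniform.\<close>

lemma continuous_on_integral_dominated_param:
  fixes f :: "'b::metric_space \<Rightarrow> real \<Rightarrow> 'a::banach"
  assumes cont: "continuous_on (U \<times> {0<..<1}) (\<lambda>(t, r). f t r)"
    and g: "g integrable_on {0..1}"
    and le: "\<And>t r. t \<in> U \<Longrightarrow> 0 < r \<Longrightarrow> r < 1 \<Longrightarrow> norm (f t r) \<le> g r"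
  shows "continuous_on U (\<lambda>t. integral {0..1} (f t))"
proof (rule uniform_limit_theorem[where F = sequentially])
  \<comment> \<open>The shift by 3 keeps both cut-offs below 1/2, so the truncated interval is never
    empty.\<close>
  define \<epsilon> :: "nat \<Rightarrow> real" where "\<epsilon> n = 1 / (n + 3)" for n
  have \<epsilon>: "0 < \<epsilon> n" "\<epsilon> n < 1 / 2" for n by (auto simp: \<epsilon>_def field_simps)
  have \<epsilon>_lim: "\<epsilon> \<longlonglongrightarrow> 0" unfolding \<epsilon>_def by real_asymp
  show "\<forall>\<^sub>F n in sequentially. continuous_on U (\<lambda>t. integral {\<epsilon> n..1 - \<epsilon> n} (f t))"
  proof (intro always_eventually allI)
    fix n
    have "continuous_on (U \<times> {\<epsilon> n..1 - \<epsilon> n}) (\<lambda>(t, r). f t r)"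
      by (rule continuous_on_subset[OF cont]) (use \<epsilon>[of n] in auto)
    then show "continuous_on U (\<lambda>t. integral {\<epsilon> n..1 - \<epsilon> n} (f t))"
      using integral_continuous_on_param[of U "\<epsilon> n" "1 - \<epsilon> n" f] by simp
  qed
  define \<Gamma> where "\<Gamma> t = integral {0..t} g" for t :: real
  have gint: "g integrable_on {s..t}" if "0 \<le> s" "t \<le> 1" for s t
    by (rule integrable_on_subinterval[OF g]) (use that in auto)
  have \<Gamma>_diff: "integral {s..t} g = \<Gamma> t - \<Gamma> s" if "0 \<le> s" "s \<le> t" "t \<le> 1" for s t
    using Henstock_Kurzweil_Integration.integral_combine[of 0 s t g] that gint[of 0 t]
    by (simp add: \<Gamma>_def)
  have \<Gamma>_cont: "continuous_on {0..1} \<Gamma>"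
    unfolding \<Gamma>_def by (rule indefinite_integral_continuous_1[OF g])
  define err where "err n = \<Gamma> (\<epsilon> n) - \<Gamma> 0 + (\<Gamma> 1 - \<Gamma> (1 - \<epsilon> n))" for n
  have "(\<lambda>n. \<Gamma> (\<epsilon> n)) \<longlonglongrightarrow> \<Gamma> 0"
    by (rule continuous_on_tendsto_compose[OF \<Gamma>_cont \<epsilon>_lim])
       (use \<epsilon> in \<open>auto intro!: always_eventually less_imp_le less_le_trans[OF \<epsilon>(2)]\<close>)
  moreover have "(\<lambda>n. \<Gamma> (1 - \<epsilon> n)) \<longlonglongrightarrow> \<Gamma> (1 - 0)"
    by (rule continuous_on_tendsto_compose[OF \<Gamma>_cont tendsto_diff[OF tendsto_const \<epsilon>_lim]])
       (use \<epsilon> in \<open>auto intro!: always_eventually less_imp_le less_le_trans[OF \<epsilon>(2)]\<close>)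
  ultimately have "err \<longlonglongrightarrow> \<Gamma> 0 - \<Gamma> 0 + (\<Gamma> 1 - \<Gamma> (1 - 0))"
    unfolding err_def by (intro tendsto_intros)
  then have err_lim: "err \<longlonglongrightarrow> 0" by simp
  have err: "norm (integral {\<epsilon> n..1 - \<epsilon> n} (f t) - integral {0..1} (f t)) \<le> err n"
    if t: "t \<in> U" for t n
  proof -
    have "continuous_on {0<..<1} (\<lambda>r. (\<lambda>(t, r). f t r) (t, r))"
      by (rule continuous_on_compose2[OF cont]) (use t in \<open>auto intro!: continuous_intros\<close>)
    then have "f t integrable_on {0..1}"
      by (intro integrable_on_dominated_open[OF _ g]) (use le t in auto)
    then have int: "f t integrable_on {a..b}" if "0 \<le> a" "b \<le> 1" for a b
      by (rule integrable_on_subinterval) (use that in auto)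
    have bd: "norm (integral {a..b} (f t)) \<le> integral {a..b} g" if "0 \<le> a" "b \<le> 1" for a b
    proof -
      \<comment> \<open>The open interval is used because the domination says nothing at 0 and
        1.\<close>
      have "norm (integral {a<..<b} (f t)) \<le> integral {a<..<b} g"
        by (rule integral_norm_bound_integral)
           (use that t le int[of a b] gint[of a b] in \<open>auto simp: integrable_on_open_interval_real\<close>)
      then show ?thesis by (simp add: integral_open_interval_real)
    qed
    have "integral {0..1} (f t) = integral {0..\<epsilon> n} (f t) + integral {\<epsilon> n..1} (f t)"
      "integral {\<epsilon> n..1} (f t) = integral {\<epsilon> n..1 - \<epsilon> n} (f t) + integral {1 - \<epsilon> n..1} (f t)"
      using \<epsilon>[of n] int
      by (auto intro!: Henstock_Kurzweil_Integration.integral_combine[symmetric])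
    then have "norm (integral {\<epsilon> n..1 - \<epsilon> n} (f t) - integral {0..1} (f t))
        = norm (integral {0..\<epsilon> n} (f t) + integral {1 - \<epsilon> n..1} (f t))"
      by (subst norm_minus_commute) (simp add: algebra_simps)
    also have "\<dots> \<le> norm (integral {0..\<epsilon> n} (f t)) + norm (integral {1 - \<epsilon> n..1} (f t))"
      by (rule norm_triangle_ineq)
    also have "\<dots> \<le> integral {0..\<epsilon> n} g + integral {1 - \<epsilon> n..1} g"
      by (intro add_mono bd) (use \<epsilon>[of n] in auto)
    also have "\<dots> = err n" using \<epsilon>[of n] by (simp add: \<Gamma>_diff err_def)
    finally show ?thesis .
  qed
  show "uniform_limit U (\<lambda>n t. integral {\<epsilon> n..1 - \<epsilon> n} (f t)) (\<lambda>t. integral {0..1} (f t)) sequentially"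
  proof (rule uniform_limitI)
    fix e :: real assume "e > 0"
    then have "\<forall>\<^sub>F n in sequentially. err n < e" using err_lim by (rule order_tendstoD(2)[rotated])
    then show "\<forall>\<^sub>F n in sequentially. \<forall>t\<in>U.
        dist (integral {\<epsilon> n..1 - \<epsilon> n} (f t)) (integral {0..1} (f t)) < e"
      by eventually_elim (use err in \<open>auto simp: dist_norm intro: le_less_trans\<close>)
  qed
qed auto

subsection \<open>The real Laplace transform of scalar functions\<close>

text \<open>A Lebesgue integral over \<open>lborel\<close> opens the way to Fubini and dominated
  convergence; the open half-line discards the value at the origin.\<close>

definition laplace_integrable :: "(real \<Rightarrow> real) \<Rightarrow> real \<Rightarrow> bool" where
  "laplace_integrable f l \<longleftrightarrow> integrable lborel (\<lambda>t. indicator {0<..} t * exp (- l * t) * f t)"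

definition laplace :: "(real \<Rightarrow> real) \<Rightarrow> real \<Rightarrow> real" where
  "laplace f l = (\<integral>t. indicator {0<..} t * exp (- l * t) * f t \<partial>lborel)"

text \<open>Absolute integrability refers to the completed measure; Borel measurability brings the
  function down to \<open>lborel\<close>, where the product measure is formed.\<close>

lemma lborel_integral_of_absolutely_integrable:
  fixes f :: "real \<Rightarrow> real"
  assumes f: "f absolutely_integrable_on S"
    and meas: "(\<lambda>t. indicator S t * f t) \<in> borel_measurable borel"
  shows "integrable lborel (\<lambda>t. indicator S t * f t)"
    and "(\<integral>t. indicator S t * f t \<partial>lborel) = integral S f"
proof -
  have "integrable lebesgue (\<lambda>t. indicator S t * f t)"
    using f by (simp add: set_integrable_def)
  then show "integrable lborel (\<lambda>t. indicator S t * f t)"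
    using meas by (simp add: integrable_completion)
  have "(\<integral>t. indicator S t * f t \<partial>lborel) = (LINT t:S|lebesgue. f t)"
    using meas by (simp add: integral_completion set_lebesgue_integral_def)
  also have "\<dots> = integral S f" using f by (rule set_lebesgue_integral_eq_integral(2))
  finally show "(\<integral>t. indicator S t * f t \<partial>lborel) = integral S f" .
qed

lemma borel_measurable_indicator_mult:
  fixes f :: "'a::topological_space \<Rightarrow> real"
  assumes "continuous_on S f" "S \<in> sets borel"
  shows "(\<lambda>t. indicator S t * f t) \<in> borel_measurable borel"
  using borel_measurable_continuous_on_indicator[OF assms(2,1)] by simp

lemma laplace_cong_pos:
  assumes "\<And>t. t > 0 \<Longrightarrow> f t = g t"
  shows "laplace_integrable f l \<longleftrightarrow> laplace_integrable g l" and "laplace f l = laplace g l"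
proof -
  have "(\<lambda>t. indicator {0<..} t * exp (- l * t) * f t) = (\<lambda>t. indicator {0<..} t * exp (- l * t) * g t)"
    using assms by (auto simp: indicator_def)
  then show "laplace_integrable f l \<longleftrightarrow> laplace_integrable g l" "laplace f l = laplace g l"
    by (simp_all add: laplace_integrable_def laplace_def)
qed

lemma laplace_integrable_mono:
  assumes "laplace_integrable f l" "l \<le> l'"
  shows "laplace_integrable f l'"
  unfolding laplace_integrable_def
proof (rule Bochner_Integration.integrable_bound)
  let ?h = "\<lambda>t. indicator {0<..} t * exp (- l * t) * f t"
  show int: "integrable lborel ?h" using assms(1) by (simp add: laplace_integrable_def)
  have eq: "(\<lambda>t. indicator {0<..} t * exp (- l' * t) * f t) = (\<lambda>t. exp (- (l' - l) * t) * ?h t)"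
    by (auto simp: fun_eq_iff algebra_simps simp flip: exp_add)
  have [measurable]: "?h \<in> borel_measurable lborel" using int by (rule borel_measurable_integrable)
  show "(\<lambda>t. indicator {0<..} t * exp (- l' * t) * f t) \<in> borel_measurable lborel"
    unfolding eq by measurable
  show "AE t in lborel. norm (indicator {0<..} t * exp (- l' * t) * f t) \<le> norm (?h t)"
    using assms(2)
    by (intro AE_I2) (auto simp: abs_mult indicator_def intro!: mult_right_mono)
qed

lemma laplace_add:
  assumes "laplace_integrable f l" "laplace_integrable g l"
  shows "laplace_integrable (\<lambda>t. f t + g t) l"
    and "laplace (\<lambda>t. f t + g t) l = laplace f l + laplace g l"
  using Bochner_Integration.integrable_add[OF assms[unfolded laplace_integrable_def]]
    Bochner_Integration.integral_add[OF assms[unfolded laplace_integrable_def]]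
  by (simp_all add: laplace_integrable_def laplace_def algebra_simps)

lemma laplace_cmult:
  assumes "laplace_integrable f l"
  shows "laplace_integrable (\<lambda>t. c * f t) l"
    and "laplace (\<lambda>t. c * f t) l = c * laplace f l"
  using integrable_mult_right[OF assms[unfolded laplace_integrable_def], of c]
    Bochner_Integration.integral_mult_right[OF assms[unfolded laplace_integrable_def], of c]
  by (simp_all add: laplace_integrable_def laplace_def algebra_simps)

lemma laplace_diff:
  assumes "laplace_integrable f l" "laplace_integrable g l"
  shows "laplace_integrable (\<lambda>t. f t - g t) l"
    and "laplace (\<lambda>t. f t - g t) l = laplace f l - laplace g l"
  using laplace_add[OF assms(1) laplace_cmult(1)[OF assms(2), of "- 1"]]
    laplace_cmult(2)[OF assms(2), of "- 1"] by simp_all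

text \<open>Differentiation under the integral sign, along one sequence of steps only. The gap
  between \<open>l0\<close> and \<open>l\<close> pays for the factor \<open>t\<close>, because
  \<open>t * exp (- (l - l0) * t)\<close> is at most \<open>1 / (l - l0)\<close> for positive
  \<open>t\<close>.\<close>

lemma laplace_difference_quotient:
  assumes int: "laplace_integrable f l0" and l: "l0 < l"
  shows "laplace_integrable (\<lambda>t. t * f t) l"
    and "(\<lambda>n. (laplace f l - laplace f (l + 1 / real (Suc n))) * real (Suc n))
           \<longlonglongrightarrow> laplace (\<lambda>t. t * f t) l"
proof -
  define h where "h t = indicator {0<..} t * exp (- l0 * t) * f t" for t
  have h_int: "integrable lborel h" using int by (simp add: laplace_integrable_def h_def[abs_def])
  have h_meas[measurable]: "h \<in> borel_measurable borel"
    using borel_measurable_integrable[OF h_int] by simp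
  define q where "q n t = exp (- (l - l0) * t) * ((1 - exp (- t / real (Suc n))) * real (Suc n)) * h t"
    for n t
  define q' where "q' t = exp (- (l - l0) * t) * t * h t" for t
  have meas: "q n \<in> borel_measurable lborel" "q' \<in> borel_measurable lborel" for n
    unfolding q_def q'_def by measurable
  have lim: "(\<lambda>n. q n t) \<longlonglongrightarrow> q' t" for t
  proof -
    have "(\<lambda>n. (1 - exp (- t / real (Suc n))) * real (Suc n)) \<longlonglongrightarrow> t"
      by real_asymp
    then show ?thesis unfolding q_def q'_def by (intro tendsto_intros)
  qed
  have bound: "norm (q n t) \<le> 1 / (l - l0) * norm (h t)" for n t
  proof (cases "t > 0")
    case True
    have "1 - t / real (Suc n) \<le> exp (- t / real (Suc n))"
      using exp_ge_add_one_self[of "- t / real (Suc n)"] by simp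
    then have "(1 - exp (- t / real (Suc n))) * real (Suc n) \<le> t"
      by (simp add: field_simps del: of_nat_Suc)
    moreover have "(l - l0) * t \<le> exp ((l - l0) * t)"
      using exp_ge_add_one_self[of "(l - l0) * t"] by linarith
    then have "exp (- (l - l0) * t) * t \<le> 1 / (l - l0)"
      using l by (simp add: field_simps exp_minus exp_diff)
    moreover have "0 \<le> 1 - exp (- t / real (Suc n))" using True by simp
    ultimately have "exp (- (l - l0) * t) * ((1 - exp (- t / real (Suc n))) * real (Suc n)) \<le> 1 / (l - l0)"
      by (meson mult_left_mono exp_ge_zero order_trans)
    moreover have "0 \<le> exp (- (l - l0) * t) * ((1 - exp (- t / real (Suc n))) * real (Suc n))"
      using \<open>0 \<le> 1 - exp (- t / real (Suc n))\<close> by simp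
    ultimately show ?thesis unfolding q_def norm_mult
      by (intro mult_right_mono) (simp_all add: abs_mult)
  qed (simp add: q_def h_def)
  have dom: "integrable lborel (\<lambda>t. 1 / (l - l0) * norm (h t))" using h_int by simp
  note dct = meas(2,1) dom AE_I2[OF lim] AE_I2[OF bound]
  have q'_int: "integrable lborel q'"
    by (rule integrable_dominated_convergence[OF dct])
  have lim_int: "(\<lambda>n. integral\<^sup>L lborel (q n)) \<longlonglongrightarrow> integral\<^sup>L lborel q'"
    by (rule integral_dominated_convergence[OF dct])
  have q'_eq: "q' = (\<lambda>t. indicator {0<..} t * exp (- l * t) * (t * f t))"
    by (auto simp: fun_eq_iff q'_def h_def algebra_simps simp flip: exp_add)
  show "laplace_integrable (\<lambda>t. t * f t) l"
    using q'_int by (simp add: q'_eq laplace_integrable_def)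
  have q_int: "integral\<^sup>L lborel (q n) = (laplace f l - laplace f (l + 1 / real (Suc n))) * real (Suc n)" for n
  proof -
    have i1: "laplace_integrable f l" and i2: "laplace_integrable f (l + 1 / real (Suc n))"
      using laplace_integrable_mono[OF int] l by (auto simp: add_increasing2 less_imp_le)
    have "q n = (\<lambda>t. (indicator {0<..} t * exp (- l * t) * f t
        - indicator {0<..} t * exp (- (l + 1 / real (Suc n)) * t) * f t) * real (Suc n))"
    proof
      fix t
      have "exp (- (l + 1 / real (Suc n)) * t) = exp (- l * t) * exp (- t / real (Suc n))"
        "exp (- l * t) = exp (- (l - l0) * t) * exp (- l0 * t)"
        by (simp_all add: algebra_simps flip: exp_add)
      then show "q n t = (indicator {0<..} t * exp (- l * t) * f t
        - indicator {0<..} t * exp (- (l + 1 / real (Suc n)) * t) * f t) * real (Suc n)"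
        by (simp add: q_def h_def algebra_simps del: of_nat_Suc)
    qed
    then show ?thesis
      using i1 i2 by (simp add: laplace_integrable_def laplace_def del: of_nat_Suc)
  qed
  show "(\<lambda>n. (laplace f l - laplace f (l + 1 / real (Suc n))) * real (Suc n))
           \<longlonglongrightarrow> laplace (\<lambda>t. t * f t) l"
    using lim_int unfolding q_int q'_eq laplace_def .
qed

lemma laplace_continuous_seq:
  assumes int: "laplace_integrable f l"
  shows "(\<lambda>n. laplace f (l + 1 / real (Suc n))) \<longlonglongrightarrow> laplace f l"
proof -
  have int': "laplace_integrable f (l + 1 / real (Suc n))" for n
    using int by (rule laplace_integrable_mono) simp
  show ?thesis
    unfolding laplace_def
  proof (rule integral_dominated_convergence)
    show "integrable lborel (\<lambda>t. norm (indicator {0<..} t * exp (- l * t) * f t))"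
      using int by (simp add: laplace_integrable_def)
    show "AE t in lborel. (\<lambda>n. indicator {0<..} t * exp (- (l + 1 / real (Suc n)) * t) * f t)
        \<longlonglongrightarrow> indicator {0<..} t * exp (- l * t) * f t"
    proof (rule AE_I2)
      fix t :: real
      have "(\<lambda>n. exp (- (l + 1 / real (Suc n)) * t)) \<longlonglongrightarrow> exp (- l * t)" by real_asymp
      then show "(\<lambda>n. indicator {0<..} t * exp (- (l + 1 / real (Suc n)) * t) * f t)
        \<longlonglongrightarrow> indicator {0<..} t * exp (- l * t) * f t"
        by (rule tendsto_mult[OF tendsto_mult[OF tendsto_const] tendsto_const])
    qed
    show "AE t in lborel. norm (indicator {0<..} t * exp (- (l + 1 / real (Suc n)) * t) * f t)
        \<le> norm (indicator {0<..} t * exp (- l * t) * f t)" for n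
      by (intro AE_I2) (auto simp: abs_mult indicator_def left_diff_distrib intro!: mult_right_mono)
  qed (use int int' in \<open>auto simp: laplace_integrable_def intro: borel_measurable_integrable\<close>)
qed

section \<open>Transforms of convolutions and of indefinite integrals\<close>

lemma integrable_lborel_prod_mult:
  fixes f g :: "real \<Rightarrow> real"
  assumes f: "integrable lborel f" and g: "integrable lborel g"
  shows "integrable (lborel \<Otimes>\<^sub>M lborel) (\<lambda>(s, r). f s * g r)"
proof (rule lborel_pair.Fubini_integrable)
  note [measurable] = borel_measurable_integrable[OF f] borel_measurable_integrable[OF g]
  show "(\<lambda>(s, r). f s * g r) \<in> borel_measurable (lborel \<Otimes>\<^sub>M lborel)" by measurable
qed (use f g in \<open>auto simp: abs_mult\<close>)

text \<open>Fubini after the shear \<open>t = r + s\<close>. The kernel \<open>K\<close> is a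
  general function of two variables because \<open>\<phi> (S r (S s x))\<close> is not a product of
  scalar functions of \<open>r\<close> and \<open>s\<close>.\<close>

lemma laplace_convolution:
  fixes K :: "real \<Rightarrow> real \<Rightarrow> real" and l :: real
  defines "F \<equiv> \<lambda>s r. indicator {0<..} s * indicator {0<..} r * exp (- l * (r + s)) * K r s"
  assumes F: "integrable (lborel \<Otimes>\<^sub>M lborel) (\<lambda>(s, r). F s r)"
  shows "laplace_integrable (\<lambda>t. \<integral>s. indicator {0<..<t} s * K (t - s) s \<partial>lborel) l"
    and "laplace (\<lambda>t. \<integral>s. indicator {0<..<t} s * K (t - s) s \<partial>lborel) l
           = (\<integral>s. (\<integral>r. F s r \<partial>lborel) \<partial>lborel)"
proof -
  have [measurable]: "(\<lambda>(s, r). F s r) \<in> borel_measurable (borel \<Otimes>\<^sub>M borel)"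
    using borel_measurable_integrable[OF F] by simp
  define H where "H = (\<lambda>(s, t). F s (t - s))"
  have H_meas: "H \<in> borel_measurable (lborel \<Otimes>\<^sub>M lborel)"
  proof -
    have "(\<lambda>p. (\<lambda>(s, r). F s r) (fst p, snd p - fst p)) \<in> borel_measurable (lborel \<Otimes>\<^sub>M lborel)"
      by measurable
    then show ?thesis by (simp add: H_def case_prod_beta)
  qed
  have shift: "(\<integral>t. g (t - s) \<partial>lborel) = (\<integral>r. g r \<partial>lborel)" for g :: "real \<Rightarrow> real" and s
    using lborel_integral_real_affine[of 1 g "- s"] by (simp add: add.commute)
  have shift_int: "integrable lborel (\<lambda>t. g (t - s))" if "integrable lborel g" for g :: "real \<Rightarrow> real" and s
    using lborel_integrable_real_affine[OF that, of 1 "- s"] by (simp add: add.commute)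
  have H_int: "integrable (lborel \<Otimes>\<^sub>M lborel) H"
  proof (rule lborel_pair.Fubini_integrable[OF H_meas])
    have "integrable lborel (\<lambda>s. \<integral>r. norm (F s r) \<partial>lborel)"
      using integrable_norm[OF F] by (intro lborel_pair.integrable_fst) (simp add: case_prod_beta')
    then show "integrable lborel (\<lambda>s. \<integral>t. norm (H (s, t)) \<partial>lborel)"
      using shift[of "\<lambda>r. norm (F _ r)"] by (simp add: H_def)
    have "AE s in lborel. integrable lborel (\<lambda>r. F s r)"
      using lborel_pair.AE_integrable_fst[OF F] by simp
    then show "AE s in lborel. integrable lborel (\<lambda>t. H (s, t))"
      by eventually_elim (simp add: H_def shift_int)
  qed
  have H_eq: "H (s, t) = indicator {0<..} t * exp (- l * t) * (indicator {0<..<t} s * K (t - s) s)" for s t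
    by (auto simp: H_def F_def indicator_def)
  have inner: "(\<integral>s. H (s, t) \<partial>lborel)
      = indicator {0<..} t * exp (- l * t) * (\<integral>s. indicator {0<..<t} s * K (t - s) s \<partial>lborel)" for t
    unfolding H_eq by simp
  have H_int': "integrable (lborel \<Otimes>\<^sub>M lborel) (case_prod (\<lambda>s t. H (s, t)))"
    using H_int by simp
  show "laplace_integrable (\<lambda>t. \<integral>s. indicator {0<..<t} s * K (t - s) s \<partial>lborel) l"
    using lborel_pair.integrable_snd[OF H_int'] unfolding inner laplace_integrable_def .
  have "(\<integral>t. (\<integral>s. H (s, t) \<partial>lborel) \<partial>lborel) = (\<integral>s. (\<integral>t. H (s, t) \<partial>lborel) \<partial>lborel)"
    by (rule lborel_pair.Fubini_integral[OF H_int'])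
  also have "\<dots> = (\<integral>s. (\<integral>r. F s r \<partial>lborel) \<partial>lborel)"
    using shift[of "F _"] by (simp add: H_def)
  finally show "laplace (\<lambda>t. \<integral>s. indicator {0<..<t} s * K (t - s) s \<partial>lborel) l
           = (\<integral>s. (\<integral>r. F s r \<partial>lborel) \<partial>lborel)"
    unfolding inner laplace_def .
qed

lemma laplace_one:
  assumes "l > 0"
  shows "laplace_integrable (\<lambda>_. 1) l" and "laplace (\<lambda>_. 1) l = 1 / l"
proof -
  have I: "((\<lambda>t. exp (- l * t)) has_integral 1 / l) {0<..}"
    using has_integral_exp_minus_to_infinity[OF assms, of 0]
    by (subst has_integral_spike_set_eq[where T = "{0..}"])
       (auto intro: negligible_subset[of "{0}"])
  have ai: "(\<lambda>t. exp (- l * t)) absolutely_integrable_on {0<..}"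
    using I by (intro nonnegative_absolutely_integrable_1) auto
  note leb = lborel_integral_of_absolutely_integrable[OF ai]
  show "laplace_integrable (\<lambda>_. 1) l" using leb(1) by (simp add: laplace_integrable_def)
  show "laplace (\<lambda>_. 1) l = 1 / l" using leb(2) I by (simp add: laplace_def integral_unique)
qed

text \<open>Convolution with the constant 1, that is, the kernel \<open>K r s = f s\<close>; the
  double integrand then splits into a product.\<close>

lemma laplace_integral:
  assumes f: "laplace_integrable f l" and l: "l > 0"
  shows "laplace_integrable (\<lambda>t. \<integral>s. indicator {0<..<t} s * f s \<partial>lborel) l"
    and "laplace (\<lambda>t. \<integral>s. indicator {0<..<t} s * f s \<partial>lborel) l = laplace f l / l"
proof -
  have eq: "indicator {0<..} s * indicator {0<..} r * exp (- l * (r + s)) * f s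
      = (indicator {0<..} s * exp (- l * s) * f s) * (indicator {0<..} r * exp (- l * r) * 1)" for r s
    by (simp add: algebra_simps exp_diff exp_minus exp_add field_simps)
  have int: "integrable (lborel \<Otimes>\<^sub>M lborel)
      (\<lambda>(s, r). indicator {0<..} s * indicator {0<..} r * exp (- l * (r + s)) * f s)"
    unfolding eq using f laplace_one(1)[OF l]
    by (intro integrable_lborel_prod_mult) (simp_all add: laplace_integrable_def)
  show "laplace_integrable (\<lambda>t. \<integral>s. indicator {0<..<t} s * f s \<partial>lborel) l"
    using laplace_convolution(1)[of l "\<lambda>r s. f s"] int by simp
  have "laplace (\<lambda>t. \<integral>s. indicator {0<..<t} s * f s \<partial>lborel) l
      = (\<integral>s. (\<integral>r. indicator {0<..} s * indicator {0<..} r * exp (- l * (r + s)) * f s \<partial>lborel) \<partial>lborel)"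
    using laplace_convolution(2)[of l "\<lambda>r s. f s"] int by simp
  also have "\<dots> = (\<integral>s. (indicator {0<..} s * exp (- l * s) * f s) * laplace (\<lambda>_. 1) l \<partial>lborel)"
    unfolding eq laplace_def integral_mult_right_zero ..
  also have "\<dots> = laplace f l / l" unfolding laplace_one(2)[OF l] integral_mult_left_zero by (simp add: laplace_def)
  finally show "laplace (\<lambda>t. \<integral>s. indicator {0<..<t} s * f s \<partial>lborel) l = laplace f l / l" .
qed

lemma laplace_integrable_powr:
  assumes "a > 0" "l > 0"
  shows "laplace_integrable (\<lambda>t. t powr (a - 1)) l"
proof -
  have "(\<lambda>t. complex_of_real t powr (complex_of_real a - 1) / of_real (exp (l * t))) absolutely_integrable_on {0<..}"
    using assms by (intro absolutely_integrable_Gamma_integral) auto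
  then have "(\<lambda>t. norm (complex_of_real t powr (complex_of_real a - 1) / of_real (exp (l * t)))) absolutely_integrable_on {0<..}"
    by (rule absolutely_integrable_norm[unfolded o_def])
  also have "?this \<longleftrightarrow> (\<lambda>t. exp (- l * t) * t powr (a - 1)) absolutely_integrable_on {0<..}"
    by (intro set_integrable_cong refl)
       (simp add: norm_divide norm_powr_real_powr exp_minus field_simps)
  finally have ai: "(\<lambda>t. exp (- l * t) * t powr (a - 1)) absolutely_integrable_on {0<..}" .
  have "continuous_on {0<..} (\<lambda>t. exp (- l * t) * t powr (a - 1))"
    by (intro continuous_intros) auto
  from lborel_integral_of_absolutely_integrable(1)[OF ai borel_measurable_indicator_mult[OF this]]
  show ?thesis by (simp add: laplace_integrable_def mult.assoc)
qed

text \<open>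
  Substituting \<open>s = exp (- t)\<close> turns the transforms at \<open>l + n\<close> into moments, so by Weierstrass
  the measure \<open>exp (- l * t) * f t dt\<close> annihilates every continuous function of \<open>exp (- t)\<close>.
\<close>

lemma laplace_eq_0_imp_nonpos:
  assumes int: "laplace_integrable f l"
    and zero: "\<And>n::nat. laplace f (l + real n) = 0"
    and cont: "continuous_on {0<..} f"
    and t0: "t0 > 0"
  shows "f t0 \<le> 0"
proof (rule ccontr)
  assume "\<not> f t0 \<le> 0"
  then have pos: "f t0 > 0" by simp
  define h where "h t = indicator {0<..} t * exp (- l * t) * f t" for t
  have h_int: "integrable lborel h" using int by (simp add: laplace_integrable_def h_def[abs_def])
  have h_meas[measurable]: "h \<in> borel_measurable borel"
    using borel_measurable_integrable[OF h_int] by simp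
  have mom_eq: "(\<lambda>t. exp (- t) ^ n * h t)
      = (\<lambda>t. indicator {0<..} t * exp (- (l + real n) * t) * f t)" for n
    by (auto simp: fun_eq_iff h_def algebra_simps simp flip: exp_add exp_of_nat_mult)
  have mom_int: "integrable lborel (\<lambda>t. exp (- t) ^ n * h t)" for n
    unfolding mom_eq using laplace_integrable_mono[OF int, of "l + real n"]
    by (simp add: laplace_integrable_def)
  have mom_zero: "(\<integral>t. exp (- t) ^ n * h t \<partial>lborel) = 0" for n
    unfolding mom_eq using zero[of n] by (simp add: laplace_def)
  have poly: "integrable lborel (\<lambda>t. p (exp (- t)) * h t)
      \<and> (\<integral>t. p (exp (- t)) * h t \<partial>lborel) = 0"
    if "polynomial_function p" for p :: "real \<Rightarrow> real"
  proof -
    have "real_polynomial_function p" using that by (simp add: real_polynomial_function_eq)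
    then obtain a n where p: "p = (\<lambda>x. \<Sum>i\<le>n. a i * x ^ i)"
      unfolding real_polynomial_function_iff_sum by blast
    have "(\<lambda>t. p (exp (- t)) * h t) = (\<lambda>t. \<Sum>i\<le>n. a i * (exp (- t) ^ i * h t))"
      by (simp add: p sum_distrib_right mult.assoc)
    then show ?thesis using mom_int mom_zero by simp
  qed
  have h_cont: "continuous_on {0<..} h"
  proof -
    have "continuous_on {0<..} (\<lambda>t. exp (- l * t) * f t)"
      by (intro continuous_intros cont)
    then show ?thesis by (rule continuous_on_eq) (simp add: h_def)
  qed
  have "h t0 > 0" using t0 pos by (simp add: h_def)
  moreover have "isCont h t0" using h_cont t0 by (simp add: continuous_on_eq_continuous_at)
  ultimately have "\<forall>\<^sub>F t in at t0. h t > 0"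
    by (intro order_tendstoD(1)[of h "h t0"]) (simp_all add: isCont_def)
  then obtain d where d: "d > 0" "\<And>t. t \<noteq> t0 \<Longrightarrow> \<bar>t - t0\<bar> < d \<Longrightarrow> h t > 0"
    unfolding eventually_at by (auto simp: dist_real_def)
  have h_pos: "h t > 0" if "\<bar>t - t0\<bar> < d" for t
    using d(2)[of t] that \<open>h t0 > 0\<close> by (cases "t = t0") auto
  \<comment> \<open>The distance from \<open>exp (- t0)\<close> to the nearer image of
    \<open>t0 - d\<close> and \<open>t0 + d\<close>. The tent \<open>b\<close> of this radius,
    composed with \<open>exp (- t)\<close>, is nonzero only where \<open>h\<close> is
    positive.\<close>
  define \<delta> where "\<delta> = min (exp (- t0) - exp (- (t0 + d))) (exp (- (t0 - d)) - exp (- t0))"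
  have \<delta>: "\<delta> > 0" using d by (simp add: \<delta>_def)
  define b where "b s = max 0 (1 - \<bar>s - exp (- t0)\<bar> / \<delta>)" for s
  have b_cont: "continuous_on A b" for A unfolding b_def by (intro continuous_intros) (use \<delta> in auto)
  have [measurable]: "b \<in> borel_measurable borel"
    using b_cont by (rule borel_measurable_continuous_onI)
  have b_bound: "0 \<le> b s" "b s \<le> 1" for s using \<delta> by (auto simp: b_def)
  have near: "\<bar>t - t0\<bar> < d" if "b (exp (- t)) \<noteq> 0" for t
  proof -
    have "\<bar>exp (- t) - exp (- t0)\<bar> < \<delta>" using that \<delta> by (auto simp: b_def max_def field_simps split: if_splits)
    then have "exp (- (t0 + d)) < exp (- t)" "exp (- t) < exp (- (t0 - d))"
      unfolding \<delta>_def by linarith+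
    then show ?thesis by simp
  qed
  have bh_int: "integrable lborel (\<lambda>t. b (exp (- t)) * h t)"
    by (rule Bochner_Integration.integrable_bound[OF h_int])
       (use b_bound in \<open>auto simp: abs_mult intro!: AE_I2 mult_left_le_one_le\<close>)
  have small: "\<bar>\<integral>t. b (exp (- t)) * h t \<partial>lborel\<bar> \<le> e * (\<integral>t. \<bar>h t\<bar> \<partial>lborel)" if e: "e > 0" for e
  proof -
    \<comment> \<open>Approximation on \<open>{0..1}\<close> suffices: \<open>exp (- t)\<close> lies
      there for positive \<open>t\<close>, and \<open>h\<close> vanishes for all other
      \<open>t\<close>. Subtracting \<open>p\<close> does not change the integral, since all moments
      are zero.\<close>
    obtain p where p: "polynomial_function p" "\<And>s. s \<in> {0..1} \<Longrightarrow> norm (b s - p s) < e"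
      using Stone_Weierstrass_polynomial_function[OF compact_Icc[of 0 1] b_cont e] by metis
    have "(\<integral>t. b (exp (- t)) * h t \<partial>lborel)
        = (\<integral>t. b (exp (- t)) * h t - p (exp (- t)) * h t \<partial>lborel)"
      using poly[OF p(1)] bh_int by simp
    also have "\<bar>\<dots>\<bar> \<le> (\<integral>t. e * \<bar>h t\<bar> \<partial>lborel)"
    proof (rule integral_abs_bound_integral)
      fix t :: real
      have "\<bar>b (exp (- t)) - p (exp (- t))\<bar> * \<bar>h t\<bar> \<le> e * \<bar>h t\<bar>"
        using mult_right_mono[of "\<bar>b (exp (- t)) - p (exp (- t))\<bar>" e "\<bar>h t\<bar>"] p(2)[of "exp (- t)"]
        by (cases "t > 0") (simp_all add: h_def)
      then show "\<bar>b (exp (- t)) * h t - p (exp (- t)) * h t\<bar> \<le> e * \<bar>h t\<bar>"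
        by (simp add: abs_mult left_diff_distrib[symmetric])
    qed (use poly[OF p(1)] bh_int h_int in auto)
    also have "\<dots> = e * (\<integral>t. \<bar>h t\<bar> \<partial>lborel)" using h_int by simp
    finally show ?thesis .
  qed
  have "\<bar>\<integral>t. b (exp (- t)) * h t \<partial>lborel\<bar> \<le> 0"
  proof (rule field_le_epsilon)
    fix e :: real assume e: "e > 0"
    define N where "N = (\<integral>t. \<bar>h t\<bar> \<partial>lborel)"
    have N: "N \<ge> 0" by (simp add: N_def)
    have "\<bar>\<integral>t. b (exp (- t)) * h t \<partial>lborel\<bar> \<le> e / (1 + N) * N"
      using small[of "e / (1 + N)"] e N by (simp add: N_def[symmetric])
    also have "\<dots> \<le> e" using e N by (simp add: field_simps)
    finally show "\<bar>\<integral>t. b (exp (- t)) * h t \<partial>lborel\<bar> \<le> 0 + e" by simp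
  qed
  then have "(\<integral>t. b (exp (- t)) * h t \<partial>lborel) = 0" by simp
  moreover have "0 \<le> b (exp (- t)) * h t" for t
    using near[of t] h_pos[of t] b_bound[of "exp (- t)"] by (cases "b (exp (- t)) = 0") auto
  ultimately have "AE t in lborel. b (exp (- t)) * h t = 0"
    using integral_nonneg_eq_0_iff_AE[OF bh_int] by simp
  \<comment> \<open>The condition \<open>0 < 1 - ...\<close> is positivity of the tent written
    without \<open>max\<close>. It defines an open set, which is null by the vanishing integral and
    yet contains \<open>t0\<close>.\<close>
  then have ae: "AE t in lborel. t \<notin> {t. 0 < 1 - \<bar>exp (- t) - exp (- t0)\<bar> / \<delta>}"
  proof eventually_elim
    case (elim t)
    show ?case
    proof
      assume "t \<in> {t. 0 < 1 - \<bar>exp (- t) - exp (- t0)\<bar> / \<delta>}"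
      then have "b (exp (- t)) \<noteq> 0" by (simp only: b_def mem_Collect_eq max_def not_less split: if_split) linarith
      then show False using near[of t] h_pos[of t] elim by simp
    qed
  qed
  have op: "open {t. 0 < 1 - \<bar>exp (- t) - exp (- t0)\<bar> / \<delta>}"
    by (intro open_Collect_less continuous_intros) (use \<delta> in auto)
  then have "{t. 0 < 1 - \<bar>exp (- t) - exp (- t0)\<bar> / \<delta>} \<in> null_sets lborel"
    using ae by (subst AE_iff_null_sets) (auto simp: borel_open)
  then have "negligible {t. 0 < 1 - \<bar>exp (- t) - exp (- t0)\<bar> / \<delta>}"
    by (simp add: negligible_iff_null_sets null_sets_completionI)
  moreover have "t0 \<in> {t. 0 < 1 - \<bar>exp (- t) - exp (- t0)\<bar> / \<delta>}" by simp
  ultimately show False using open_not_negligible[OF op] by blast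
qed

text \<open>The one-sided bound is applied to \<open>f\<close> and to \<open>- f\<close>.\<close>

lemma laplace_unique:
  assumes int: "laplace_integrable f l"
    and zero: "\<And>n::nat. laplace f (l + real n) = 0"
    and cont: "continuous_on {0<..} f"
    and "t > 0"
  shows "f t = 0"
proof -
  have "laplace (\<lambda>t. - 1 * f t) (l + real n) = 0" for n
    using laplace_cmult(2)[OF laplace_integrable_mono[OF int, of "l + real n"], of "- 1"] zero[of n]
    by simp
  then have "- 1 * f t \<le> 0"
    using assms laplace_cmult(1)[OF int, of "- 1"]
    by (intro laplace_eq_0_imp_nonpos[of _ l]) (auto intro!: continuous_intros)
  moreover have "f t \<le> 0" using assms by (rule laplace_eq_0_imp_nonpos)
  ultimately show ?thesis by simp
qed

subsection \<open>Resolvent families\<close>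

text \<open>The bridge from the integral in \<open>op_conv\<close> to the Lebesgue integral in
  \<open>laplace_convolution\<close>.\<close>

lemma lborel_integral_dominated_open:
  fixes c g :: "real \<Rightarrow> real"
  assumes cont: "continuous_on {0<..<t} c" and g: "g integrable_on {0..t}"
    and le: "\<And>s. 0 < s \<Longrightarrow> s < t \<Longrightarrow> \<bar>c s\<bar> \<le> g s"
  shows "(\<integral>s. indicator {0<..<t} s * c s \<partial>lborel) = integral {0..t} c"
proof -
  have "c integrable_on {0..t}"
    using cont g by (rule integrable_on_dominated_open) (simp add: le)
  then have "c integrable_on {0<..<t}" by (simp add: integrable_on_open_interval_real)
  moreover have "g integrable_on {0<..<t}" using g by (simp add: integrable_on_open_interval_real)
  ultimately have "c absolutely_integrable_on {0<..<t}"
    by (rule absolutely_integrable_integrable_bound[rotated]) (simp add: le)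
  from lborel_integral_of_absolutely_integrable(2)[OF this borel_measurable_indicator_mult[OF cont]]
  show ?thesis by (simp add: integral_open_interval_real)
qed

lemma gker_1: "t \<noteq> 0 \<Longrightarrow> gker 1 t = 1"
  by (simp add: gker_def)

lemma integral_gker_1:
  "integral {0..T} (\<lambda>s. gker 1 (T - s) *\<^sub>R f s) = integral {0..T} f"
  \<comment> \<open>At \<open>s = T\<close> the kernel is \<open>gker 1 0 = 0\<close> instead of 1,
    hence the exceptional point.\<close>
  by (rule integral_spike[of "{T}"]) (auto simp: gker_1)

text \<open>The witnesses of the existential quantifiers are fixed once. The exponent
  \<open>w\<close> can be taken nonnegative by enlarging it, which makes \<open>exp (w * t)\<close>
  monotone in \<open>t\<close>.\<close>

locale alpha_resolvent_family =
  fixes \<alpha> :: real and D :: "'a::complex_banach set" and A :: "'a \<Rightarrow> 'a"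
    and S :: "real \<Rightarrow> 'a \<Rightarrow> 'a" and M w \<omega> :: real
  assumes \<alpha>: "0 < \<alpha>" "\<alpha> < 1"
    and S_bounded_clinear: "\<And>t. t > 0 \<Longrightarrow> bounded_clinear (S t)"
    and S_continuous: "\<And>x. continuous_on {0<..} (\<lambda>t. S t x)"
    and M: "M > 0" and w: "w \<ge> 0"
    and S_onorm: "\<And>t. t > 0 \<Longrightarrow> onorm (S t) \<le> M * max 1 (t powr (\<alpha> - 1)) * exp (w * t)"
    and \<omega>: "\<omega> \<ge> 0"
    and resolvent_set: "\<And>z. Re z > \<omega> \<Longrightarrow> z powr complex_of_real \<alpha> \<in> resolvent_set D A"
    and S_laplace: "\<And>x z. Re z > \<omega> \<Longrightarrow>
       ((\<lambda>t. exp (- z * complex_of_real t) *\<^sub>C S t x) has_integral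
            (z powr complex_of_real (\<alpha> - \<alpha>)) *\<^sub>C
              resolvent D A (z powr complex_of_real \<alpha>) x) {0..}"
begin

abbreviation Rs :: "real \<Rightarrow> 'a \<Rightarrow> 'a" where
  "Rs l \<equiv> resolvent D A (complex_of_real (l powr \<alpha>))"

section \<open>The resolvents at real points\<close>

lemma S_bounded_linear: "t > 0 \<Longrightarrow> bounded_linear (S t)"
  using S_bounded_clinear by (simp add: bounded_clinear_def)

lemma Rs_in_resolvent_set: "l > \<omega> \<Longrightarrow> complex_of_real (l powr \<alpha>) \<in> resolvent_set D A"
  using resolvent_set[of "complex_of_real l"] \<omega> by (simp add: powr_of_real)

lemma Rs_bounded_linear: "l > \<omega> \<Longrightarrow> bounded_linear (Rs l)"
  using Rs_in_resolvent_set by (auto simp: resolvent_set_def bounded_clinear_def)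

lemma
  assumes l: "l > \<omega>"
  shows Rs_in_D: "Rs l y \<in> D"
    and Rs_right: "(l powr \<alpha>) *\<^sub>R Rs l y - A (Rs l y) = y"
    and Rs_left: "d \<in> D \<Longrightarrow> Rs l ((l powr \<alpha>) *\<^sub>R d - A d) = d"
proof -
  have bij: "bij_betw (\<lambda>y. (l powr \<alpha>) *\<^sub>R y - A y) D UNIV"
    using Rs_in_resolvent_set[OF l] by (simp add: resolvent_set_def scaleC_of_real)
  have R: "Rs l = inv_into D (\<lambda>y. (l powr \<alpha>) *\<^sub>R y - A y)"
    by (simp add: resolvent_def scaleC_of_real)
  show "Rs l y \<in> D" unfolding R using bij by (intro inv_into_into) (auto simp: bij_betw_def)
  show "(l powr \<alpha>) *\<^sub>R Rs l y - A (Rs l y) = y"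
    unfolding R by (rule bij_betw_inv_into_right[OF bij]) simp
  show "d \<in> D \<Longrightarrow> Rs l ((l powr \<alpha>) *\<^sub>R d - A d) = d"
    unfolding R by (rule bij_betw_inv_into_left[OF bij])
qed

text \<open>The left inverse property at \<open>m\<close> is applied to \<open>Rs l y\<close>, and
  the right inverse property at \<open>l\<close> eliminates \<open>A\<close>.\<close>

lemma resolvent_identity:
  assumes "l > \<omega>" "m > \<omega>"
  shows "Rs l y = Rs m y + (m powr \<alpha> - l powr \<alpha>) *\<^sub>R Rs m (Rs l y)"
proof -
  interpret bounded_linear "Rs m" using assms(2) by (rule Rs_bounded_linear)
  have "Rs l y = Rs m ((m powr \<alpha>) *\<^sub>R Rs l y - A (Rs l y))"
    using Rs_left[OF assms(2) Rs_in_D[OF assms(1)]] by simp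
  also have "(m powr \<alpha>) *\<^sub>R Rs l y - A (Rs l y) = y + (m powr \<alpha> - l powr \<alpha>) *\<^sub>R Rs l y"
    using Rs_right[OF assms(1), of y] by (simp add: algebra_simps)
  finally show ?thesis unfolding add scaleR .
qed

section \<open>Growth of the family and its scalar transforms\<close>

definition S_bound :: "real \<Rightarrow> real" where
  "S_bound t = M * max 1 (t powr (\<alpha> - 1)) * exp (w * t)"

lemma S_bound_nonneg: "S_bound t \<ge> 0"
  using M by (simp add: S_bound_def)

lemma S_bound_continuous: "continuous_on {0<..} S_bound"
  unfolding S_bound_def by (intro continuous_intros) auto

lemma norm_S_le:
  assumes "t > 0"
  shows "norm (S t y) \<le> S_bound t * norm y"
proof -
  have "norm (S t y) \<le> onorm (S t) * norm y" using assms by (intro onorm S_bounded_linear)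
  also have "\<dots> \<le> S_bound t * norm y"
    using S_onorm[OF assms] unfolding S_bound_def by (rule mult_right_mono) simp
  finally show ?thesis .
qed

text \<open>On a bounded range the maximum is absorbed into a single power, because
  \<open>N powr (1 - \<alpha>) * t powr (\<alpha> - 1)\<close> is at least 1 there. A pure power
  leads to Beta integrals for the convolution.\<close>

lemma S_bound_le_powr:
  assumes "0 < t" "t \<le> N" "1 \<le> N"
  shows "S_bound t \<le> (M * N powr (1 - \<alpha>) * exp (w * N)) * t powr (\<alpha> - 1)"
proof -
  have "N powr (\<alpha> - 1) \<le> t powr (\<alpha> - 1)"
    using assms \<alpha> by (intro powr_mono2') auto
  then have "N powr (1 - \<alpha>) * N powr (\<alpha> - 1) \<le> N powr (1 - \<alpha>) * t powr (\<alpha> - 1)"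
    by (intro mult_left_mono) auto
  then have "1 \<le> N powr (1 - \<alpha>) * t powr (\<alpha> - 1)"
    using assms by (simp flip: powr_add)
  moreover have "1 * t powr (\<alpha> - 1) \<le> N powr (1 - \<alpha>) * t powr (\<alpha> - 1)"
    using assms \<alpha> by (intro mult_right_mono ge_one_powr_ge_zero) auto
  ultimately have "max 1 (t powr (\<alpha> - 1)) \<le> N powr (1 - \<alpha>) * t powr (\<alpha> - 1)" by simp
  then have "M * max 1 (t powr (\<alpha> - 1)) * exp (w * t)
      \<le> M * (N powr (1 - \<alpha>) * t powr (\<alpha> - 1)) * exp (w * N)"
    using M w assms by (intro mult_mono mult_left_mono) (auto simp: mult_left_mono)
  then show ?thesis by (simp add: S_bound_def mult_ac)
qed

lemma laplace_integrable_S_bound: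
  assumes "l > w"
  shows "laplace_integrable S_bound l"
proof -
  let ?g = "\<lambda>t. M * (1 + t powr (\<alpha> - 1))"
  have "laplace_integrable ?g (l - w)"
    using assms \<alpha> by (intro laplace_cmult laplace_add laplace_one laplace_integrable_powr) auto
  then have int: "integrable lborel (\<lambda>t. indicator {0<..} t * exp (- (l - w) * t) * ?g t)"
    by (simp add: laplace_integrable_def)
  have "continuous_on {0<..} (\<lambda>t. exp (- l * t) * S_bound t)"
    by (intro continuous_intros S_bound_continuous)
  from borel_measurable_indicator_mult[OF this]
  have meas: "(\<lambda>t. indicator {0<..} t * exp (- l * t) * S_bound t) \<in> borel_measurable lborel"
    by (simp add: mult.assoc)
  have "norm (indicator {0<..} t * exp (- l * t) * S_bound t)
      \<le> norm (indicator {0<..} t * exp (- (l - w) * t) * ?g t)" for t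
  proof (cases "t > 0")
    case True
    have "exp (- l * t) * S_bound t = exp (- (l - w) * t) * (M * max 1 (t powr (\<alpha> - 1)))"
      by (simp add: S_bound_def algebra_simps flip: exp_add)
    also have "\<dots> \<le> exp (- (l - w) * t) * ?g t"
      using M by (intro mult_left_mono) auto
    finally show ?thesis using True S_bound_nonneg[of t] M by (simp add: abs_mult)
  qed simp
  with int meas show ?thesis
    unfolding laplace_integrable_def by (intro Bochner_Integration.integrable_bound[OF int] AE_I2)
qed

lemma laplace_integrable_bounded:
  assumes "l > w" and cont: "continuous_on {0<..} f"
    and le: "\<And>t. t > 0 \<Longrightarrow> \<bar>f t\<bar> \<le> B * S_bound t"
  shows "laplace_integrable f l"
proof -
  have int: "integrable lborel (\<lambda>t. indicator {0<..} t * exp (- l * t) * (B * S_bound t))"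
    using laplace_cmult(1)[OF laplace_integrable_S_bound[OF assms(1)], of B]
    by (simp add: laplace_integrable_def)
  have "continuous_on {0<..} (\<lambda>t. exp (- l * t) * f t)"
    by (intro continuous_intros cont)
  from borel_measurable_indicator_mult[OF this]
  have meas: "(\<lambda>t. indicator {0<..} t * exp (- l * t) * f t) \<in> borel_measurable lborel"
    by (simp add: mult.assoc)
  have "norm (indicator {0<..} t * exp (- l * t) * f t)
      \<le> norm (indicator {0<..} t * exp (- l * t) * (B * S_bound t))" for t
    using order_trans[OF le[of t] abs_ge_self] by (cases "t > 0") (auto simp: abs_mult)
  with int meas show ?thesis
    unfolding laplace_integrable_def by (intro Bochner_Integration.integrable_bound[OF int] AE_I2)
qed

text \<open>The growth bound gives Lebesgue integrability, after which the value may be taken from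
  the Henstock-Kurzweil integral at the real point \<open>l\<close>.\<close>

lemma
  fixes \<phi> :: "'a \<Rightarrow> real"
  assumes \<phi>: "bounded_linear \<phi>" and l: "l > \<omega>" "l > w"
  shows laplace_integrable_S: "laplace_integrable (\<lambda>t. \<phi> (S t y)) l"
    and laplace_S: "laplace (\<lambda>t. \<phi> (S t y)) l = \<phi> (Rs l y)"
proof -
  obtain B where B: "\<And>y. \<bar>\<phi> y\<bar> \<le> norm y * B" "B > 0"
    using bounded_linear.pos_bounded[OF \<phi>] by auto
  have cont: "continuous_on {0<..} (\<lambda>t. \<phi> (S t y))"
    by (intro bounded_linear.continuous_on[OF \<phi>] S_continuous)
  have "\<bar>\<phi> (S t y)\<bar> \<le> (norm y * B) * S_bound t" if "t > 0" for t
    using order_trans[OF B(1)[of "S t y"] mult_right_mono[OF norm_S_le[OF that, of y], of B]] B(2)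
    by (simp add: mult_ac)
  then show int: "laplace_integrable (\<lambda>t. \<phi> (S t y)) l"
    by (rule laplace_integrable_bounded[OF l(2) cont])
  have "((\<lambda>t. exp (- l * t) *\<^sub>R S t y) has_integral Rs l y) {0..}"
  proof -
    have "exp (- complex_of_real l * complex_of_real t) = complex_of_real (exp (- l * t))" for t
      by (simp flip: exp_of_real)
    \<comment> \<open>The prefactor \<open>z powr (\<alpha> - \<alpha>)\<close> is 1, as
      \<open>l\<close> is positive.\<close>
    then show ?thesis
      using S_laplace[of "complex_of_real l" y] l \<omega>
      by (simp add: scaleC_of_real powr_of_real scaleC_of_real[of 1, simplified])
  qed
  from has_integral_linear[OF this \<phi>]
  have hi0: "((\<lambda>t. exp (- l * t) * \<phi> (S t y)) has_integral \<phi> (Rs l y)) {0..}"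
    by (simp add: o_def linear_simps[OF \<phi>])
  have hi: "((\<lambda>t. exp (- l * t) * \<phi> (S t y)) has_integral \<phi> (Rs l y)) {0<..}"
    using hi0 by (subst has_integral_spike_set_eq[where T = "{0..}"])
      (auto intro: negligible_subset[of "{0}"])
  have "set_integrable lborel {0<..} (\<lambda>t. exp (- l * t) * \<phi> (S t y))"
    using int by (simp add: laplace_integrable_def set_integrable_def mult.assoc)
  from set_borel_integral_eq_integral(2)[OF this] hi
  show "laplace (\<lambda>t. \<phi> (S t y)) l = \<phi> (Rs l y)"
    by (simp add: laplace_def set_lebesgue_integral_def mult.assoc integral_unique)
qed

section \<open>The convolution of the family with itself\<close>

lemma S_S_continuous: "continuous_on ({0<..} \<times> {0<..}) (\<lambda>(r, s). S r (S s x))"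
  unfolding continuous_on_def
proof (clarify)
  fix r0 s0 :: real assume pos: "0 < r0" "0 < s0"
  let ?X = "{0<..} \<times> {0<..} :: (real \<times> real) set" and ?F = "at (r0, s0) within {0<..} \<times> {0<..}"
  define y0 where "y0 = S s0 x"
  \<comment> \<open>Joint continuity follows from strong continuity and the local bound:
    \<open>e\<close> dominates the splitting of the difference into \<open>S r (S s x - y0)\<close>
    and \<open>S r y0 - S r0 y0\<close>.\<close>
  define e where "e p = S_bound (fst p) * norm (S (snd p) x - y0) + norm (S (fst p) y0 - S r0 y0)" for p
  have "continuous_on ?X e"
    unfolding e_def
    by (intro continuous_intros continuous_on_compose2[OF S_bound_continuous]
        continuous_on_compose2[OF S_continuous]) auto
  then have "(e \<longlongrightarrow> e (r0, s0)) ?F"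
    using pos by (simp add: continuous_on_def)
  then have e_lim: "(e \<longlongrightarrow> 0) ?F" by (simp add: e_def y0_def)
  have "norm ((case p of (r, s) \<Rightarrow> S r (S s x)) - S r0 y0) \<le> e p" if "p \<in> ?X" for p
  proof -
    obtain r s where p: "p = (r, s)" "r > 0" "s > 0" using \<open>p \<in> ?X\<close> by auto
    have "S r (S s x) - S r0 y0 = S r (S s x - y0) + (S r y0 - S r0 y0)"
      using linear_simps(2)[OF S_bounded_linear[OF p(2)]] by simp
    also have "norm \<dots> \<le> norm (S r (S s x - y0)) + norm (S r y0 - S r0 y0)"
      by (rule norm_triangle_ineq)
    also have "\<dots> \<le> e p" using norm_S_le[OF p(2)] by (simp add: e_def p(1))
    finally show ?thesis by (simp add: p(1))
  qed
  then have "((\<lambda>p. (case p of (r, s) \<Rightarrow> S r (S s x)) - S r0 y0) \<longlongrightarrow> 0) ?F"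
    by (intro Lim_null_comparison[OF _ e_lim]) (auto simp: eventually_at_filter)
  then show "((\<lambda>(r, s). S r (S s x)) \<longlongrightarrow> S r0 (S s0 x)) ?F"
    by (simp add: y0_def LIM_zero_cancel)
qed

lemma norm_S_S_le: "r > 0 \<Longrightarrow> s > 0 \<Longrightarrow> norm (S r (S s x)) \<le> S_bound r * S_bound s * norm x"
  using norm_S_le[of r "S s x"] mult_left_mono[OF norm_S_le[of s x] S_bound_nonneg[of r]]
  by (simp add: mult_ac)

text \<open>
  The substitution \<open>s = t * r\<close> gives both singularities of \<open>S (t - s) (S s x)\<close> a place independent
  of \<open>t\<close>; the factor \<open>t powr (1 - 2 * \<alpha>)\<close> makes the bound by the Beta kernel uniform in \<open>t\<close>.
\<close>

lemma
  assumes N: "1 \<le> N"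
  shows S_conv_S_integrable: "0 < t \<Longrightarrow> t \<le> N \<Longrightarrow> (\<lambda>s. S (t - s) (S s x)) integrable_on {0..t}"
    and S_conv_S_continuous_upto: "continuous_on {0<..N} (\<lambda>t. (S \<star> S) t x)"
    and S_conv_S_bound: "\<exists>C\<ge>0. \<forall>t. 0 < t \<and> t \<le> N \<longrightarrow> norm ((S \<star> S) t x) \<le> C * t powr (2 * \<alpha> - 1)"
proof -
  define c where "c = M * N powr (1 - \<alpha>) * exp (w * N)"
  \<comment> \<open>The Beta kernel with both parameters \<alpha>; each of the two factors
    \<open>S\<close> contributes one constant \<open>c\<close>.\<close>
  define g where "g r = c\<^sup>2 * norm x * (r powr (\<alpha> - 1) * (1 - r) powr (\<alpha> - 1))" for r
  \<comment> \<open>The exponent \<open>2 - 2 * \<alpha>\<close> cancels the two singularities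
    alone; the Jacobian \<open>t\<close> of the substitution is restored in \<open>W\<close>, which
    leaves \<open>t powr (2 * \<alpha> - 1)\<close> in front.\<close>
  define f where "f t r = t powr (2 - 2 * \<alpha>) *\<^sub>R S (t * (1 - r)) (S (t * r) x)" for t r
  have c: "c \<ge> 0" using M by (simp add: c_def)
  have g_int: "g integrable_on {0..1}"
    unfolding g_def using has_integral_Beta_real[OF \<alpha>(1) \<alpha>(1)]
    by (intro integrable_on_mult_right) (auto simp: integrable_on_def)
  have f_cont: "continuous_on ({0<..N} \<times> {0<..<1}) (\<lambda>(t, r). f t r)"
  proof -
    have "continuous_on ({0<..N} \<times> {0<..<1})
        (\<lambda>p. fst p powr (2 - 2 * \<alpha>) *\<^sub>R (\<lambda>(r, s). S r (S s x)) (fst p * (1 - snd p), fst p * snd p))"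
      by (intro continuous_intros continuous_on_compose2[OF S_S_continuous]) auto
    then show ?thesis by (simp add: f_def case_prod_beta')
  qed
  have f_le: "norm (f t r) \<le> g r" if t: "t \<in> {0<..N}" and r: "0 < r" "r < 1" for t r
  proof -
    have "t * (1 - r) \<le> t" "t * r \<le> t" using t r by (auto intro!: mult_left_le)
    moreover have "t \<le> N" using t by simp
    ultimately have le: "t * (1 - r) \<le> N" "t * r \<le> N" by linarith+
    have pos: "0 < t * (1 - r)" "0 < t * r" using t r by auto
    note p = pos le
    have "norm (S (t * (1 - r)) (S (t * r) x)) \<le> S_bound (t * (1 - r)) * S_bound (t * r) * norm x"
      by (rule norm_S_S_le[OF p(1,2)])
    also have "\<dots> \<le> (c * (t * (1 - r)) powr (\<alpha> - 1)) * (c * (t * r) powr (\<alpha> - 1)) * norm x"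
      using S_bound_le_powr[OF p(1,3) N] S_bound_le_powr[OF p(2,4) N] S_bound_nonneg c
      by (intro mult_right_mono mult_mono) (auto simp: c_def)
    also have "\<dots> = t powr (2 * \<alpha> - 2) * g r"
    proof -
      have "t powr (2 * \<alpha> - 2) = t powr (\<alpha> - 1) * t powr (\<alpha> - 1)" by (simp flip: powr_add)
      then show ?thesis
        using t r by (simp add: g_def powr_mult power2_eq_square mult_ac)
    qed
    finally have "norm (f t r) \<le> t powr (2 - 2 * \<alpha>) * (t powr (2 * \<alpha> - 2) * g r)"
      unfolding f_def norm_scaleR by (intro mult_mono) auto
    also have "\<dots> = g r" using t by (simp flip: powr_add mult.assoc)
    finally show ?thesis .
  qed
  have V_cont: "continuous_on {0<..N} (\<lambda>t. integral {0..1} (f t))"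
    using f_cont g_int f_le by (rule continuous_on_integral_dominated_param)
  have f_int: "f t integrable_on {0..1}" if t: "t \<in> {0<..N}" for t
  proof (rule integrable_on_dominated_open[OF _ g_int])
    have "continuous_on {0<..<1} (\<lambda>r. (\<lambda>(t, r). f t r) (t, r))"
      by (rule continuous_on_compose2[OF f_cont]) (use t in \<open>auto intro!: continuous_intros\<close>)
    then show "continuous_on {0<..<1} (f t)" by simp
  qed (use f_le t in auto)
  have W: "((\<lambda>s. S (t - s) (S s x)) has_integral t powr (2 * \<alpha> - 1) *\<^sub>R integral {0..1} (f t)) {0..t}"
    if t: "t \<in> {0<..N}" for t
  proof -
    have "(f t has_integral integral {0..1} (f t)) (cbox 0 1)"
      using f_int[OF t] by (simp add: has_integral_integral)
    from has_integral_affinity[OF this, of "1 / t" 0] t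
    have "((\<lambda>s. f t (s / t)) has_integral t *\<^sub>R integral {0..1} (f t)) {0..t}"
      by (simp add: image_mult_atLeastAtMost mult.commute[of _ t] mult.commute[of _ "inverse t"] divide_inverse)
    from has_integral_cmul[OF this, of "t powr (2 * \<alpha> - 2)"]
    have "((\<lambda>s. t powr (2 * \<alpha> - 2) *\<^sub>R f t (s / t)) has_integral
        (t powr (2 * \<alpha> - 2) * t) *\<^sub>R integral {0..1} (f t)) {0..t}" by simp
    moreover have "t powr (2 * \<alpha> - 2) * t = t powr (2 * \<alpha> - 1)"
      using t powr_add[of t "2 * \<alpha> - 2" 1] by simp
    moreover have "t powr (2 * \<alpha> - 2) *\<^sub>R f t (s / t) = S (t - s) (S s x)" for s
    proof -
      have "t powr (2 * \<alpha> - 2) * t powr (2 - 2 * \<alpha>) = 1" using t by (simp flip: powr_add)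
      moreover have "t * (1 - s / t) = t - s" "t * (s / t) = s" using t by (auto simp: field_simps)
      ultimately show ?thesis by (simp add: f_def)
    qed
    ultimately show ?thesis by simp
  qed
  show "(\<lambda>s. S (t - s) (S s x)) integrable_on {0..t}" if "0 < t" "t \<le> N" for t
    using W[of t] that by (auto simp: integrable_on_def)
  have W_eq: "(S \<star> S) t x = t powr (2 * \<alpha> - 1) *\<^sub>R integral {0..1} (f t)" if "t \<in> {0<..N}" for t
    unfolding op_conv_def using W[OF that] by (rule integral_unique)
  have "continuous_on {0<..N} (\<lambda>t. t powr (2 * \<alpha> - 1) *\<^sub>R integral {0..1} (f t))"
    by (intro continuous_intros V_cont) auto
  then show "continuous_on {0<..N} (\<lambda>t. (S \<star> S) t x)"
    by (rule continuous_on_eq) (simp add: W_eq)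
  show "\<exists>C\<ge>0. \<forall>t. 0 < t \<and> t \<le> N \<longrightarrow> norm ((S \<star> S) t x) \<le> C * t powr (2 * \<alpha> - 1)"
  proof (intro exI[of _ "integral {0..1} g"] conjI allI impI)
    show "0 \<le> integral {0..1} g" by (rule integral_nonneg[OF g_int]) (simp add: g_def)
    fix t assume t: "0 < t \<and> t \<le> N"
    have "norm (integral {0<..<1} (f t)) \<le> integral {0<..<1} g"
      using f_int[of t] g_int f_le[of t] t
      by (intro integral_norm_bound_integral) (auto simp: integrable_on_open_interval_real)
    then have "norm (integral {0..1} (f t)) \<le> integral {0..1} g"
      by (simp add: integral_open_interval_real)
    then show "norm ((S \<star> S) t x) \<le> integral {0..1} g * t powr (2 * \<alpha> - 1)"
      using t by (simp add: W_eq mult.commute mult_left_mono)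
  qed
qed

lemma S_conv_S_continuous: "continuous_on {0<..} (\<lambda>t. (S \<star> S) t x)"
  unfolding continuous_on_eq_continuous_at[OF open_greaterThan]
proof
  fix t :: real assume t: "t \<in> {0<..}"
  have "continuous_on {0<..<t + 1} (\<lambda>t. (S \<star> S) t x)"
    by (rule continuous_on_subset[OF S_conv_S_continuous_upto[of "t + 1"]]) (use t in auto)
  then show "isCont (\<lambda>t. (S \<star> S) t x) t"
    using t by (simp add: continuous_on_eq_continuous_at)
qed

text \<open>Supplies the dominating function for the scalar integrand of the convolution, by
  rescaling the Beta integral to \<open>{0..t}\<close>.\<close>

lemma S_bound_conv_integrable:
  assumes t: "t > 0"
  shows "(\<lambda>s. S_bound (t - s) * S_bound s) integrable_on {0..t}"
proof -
  define N where "N = max 1 t"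
  define c where "c = M * N powr (1 - \<alpha>) * exp (w * N)"
  have c: "c \<ge> 0" using M by (simp add: c_def)
  have "((\<lambda>r. r powr (\<alpha> - 1) * (1 - r) powr (\<alpha> - 1)) has_integral Beta \<alpha> \<alpha>) (cbox 0 1)"
    using has_integral_Beta_real[OF \<alpha>(1) \<alpha>(1)] by simp
  from has_integral_affinity[OF this, of "1 / t" 0] t
  have "(\<lambda>s. (s / t) powr (\<alpha> - 1) * (1 - s / t) powr (\<alpha> - 1)) integrable_on {0..t}"
    by (auto simp: image_mult_atLeastAtMost mult.commute[of _ t] mult.commute[of _ "inverse t"]
        divide_inverse integrable_on_def)
  then have g: "(\<lambda>s. c\<^sup>2 * (t powr (\<alpha> - 1))\<^sup>2 * ((s / t) powr (\<alpha> - 1) * (1 - s / t) powr (\<alpha> - 1)))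
      integrable_on {0..t}"
    by (rule integrable_on_mult_right)
  show ?thesis
  proof (rule integrable_on_dominated_open[OF _ g])
    show "continuous_on {0<..<t} (\<lambda>s. S_bound (t - s) * S_bound s)"
      by (intro continuous_intros continuous_on_compose2[OF S_bound_continuous]) auto
    fix s assume s: "0 < s" "s < t"
    have "norm (S_bound (t - s) * S_bound s) \<le> (c * (t - s) powr (\<alpha> - 1)) * (c * s powr (\<alpha> - 1))"
      using s S_bound_nonneg c S_bound_le_powr[of "t - s" N] S_bound_le_powr[of s N]
      by (simp add: abs_mult mult_mono c_def N_def)
    also have "(t - s) powr (\<alpha> - 1) = t powr (\<alpha> - 1) * (1 - s / t) powr (\<alpha> - 1)"
      using s t powr_mult[of t "1 - s / t" "\<alpha> - 1"] by (simp add: right_diff_distrib)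
    also have "s powr (\<alpha> - 1) = t powr (\<alpha> - 1) * (s / t) powr (\<alpha> - 1)"
      using s t powr_mult[of t "s / t" "\<alpha> - 1"] by simp
    finally show "norm (S_bound (t - s) * S_bound s)
        \<le> c\<^sup>2 * (t powr (\<alpha> - 1))\<^sup>2 * ((s / t) powr (\<alpha> - 1) * (1 - s / t) powr (\<alpha> - 1))"
      by (simp add: power2_eq_square mult_ac)
  qed
qed

lemma functional_S_conv_S:
  fixes \<phi> :: "'a \<Rightarrow> real"
  assumes \<phi>: "bounded_linear \<phi>" and t: "t > 0"
  shows "\<phi> ((S \<star> S) t x) = (\<integral>s. indicator {0<..<t} s * \<phi> (S (t - s) (S s x)) \<partial>lborel)"
proof -
  obtain B where B: "\<And>y. \<bar>\<phi> y\<bar> \<le> norm y * B" "B > 0"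
    using bounded_linear.pos_bounded[OF \<phi>] by auto
  have "\<phi> ((S \<star> S) t x) = integral {0..t} (\<lambda>s. \<phi> (S (t - s) (S s x)))"
    unfolding op_conv_def
    using integral_linear[OF S_conv_S_integrable[of "max 1 t" t x] \<phi>] t by (simp add: o_def)
  also have "\<dots> = (\<integral>s. indicator {0<..<t} s * \<phi> (S (t - s) (S s x)) \<partial>lborel)"
  proof (rule lborel_integral_dominated_open[symmetric])
    have "continuous_on {0<..<t} (\<lambda>s. (\<lambda>(r, s). S r (S s x)) (t - s, s))"
      by (intro continuous_on_compose2[OF S_S_continuous] continuous_intros) auto
    then show "continuous_on {0<..<t} (\<lambda>s. \<phi> (S (t - s) (S s x)))"
      by (intro bounded_linear.continuous_on[OF \<phi>]) simp
    show "(\<lambda>s. norm x * B * (S_bound (t - s) * S_bound s)) integrable_on {0..t}"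
      by (intro integrable_on_mult_right S_bound_conv_integrable t)
    fix s assume s: "0 < s" "s < t"
    have "norm (S (t - s) (S s x)) * B \<le> (S_bound (t - s) * S_bound s * norm x) * B"
      using s B by (intro mult_right_mono norm_S_S_le) auto
    then show "\<bar>\<phi> (S (t - s) (S s x))\<bar> \<le> norm x * B * (S_bound (t - s) * S_bound s)"
      using B(1)[of "S (t - s) (S s x)"] by (simp add: mult_ac)
  qed
  finally show ?thesis .
qed

text \<open>In the double integral the variable \<open>r\<close> is integrated first, with the
  vector \<open>S s x\<close> held fixed. This turns \<phi> into the bounded functional
  \<open>\<phi>\<close> after \<open>Rs l\<close>, and the transform of \<open>S\<close> is used a
  second time with that functional.\<close>

lemma
  fixes \<phi> :: "'a \<Rightarrow> real"
  assumes \<phi>: "bounded_linear \<phi>" and l: "l > \<omega>" "l > w"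
  shows laplace_integrable_S_conv_S: "laplace_integrable (\<lambda>t. \<phi> ((S \<star> S) t x)) l"
    and laplace_S_conv_S: "laplace (\<lambda>t. \<phi> ((S \<star> S) t x)) l = \<phi> (Rs l (Rs l x))"
proof -
  obtain B where B: "\<And>y. \<bar>\<phi> y\<bar> \<le> norm y * B" "B > 0"
    using bounded_linear.pos_bounded[OF \<phi>] by auto
  define F where
    "F s r = indicator {0<..} s * indicator {0<..} r * exp (- l * (r + s)) * \<phi> (S r (S s x))" for s r
  define p where "p t = indicator {0<..} t * exp (- l * t) * S_bound t" for t
  have p_int: "integrable lborel p"
    using laplace_integrable_S_bound[OF l(2)] by (simp add: laplace_integrable_def p_def[abs_def])
  have F_split: "F s r = indicator {0<..} s * exp (- l * s) * (indicator {0<..} r * exp (- l * r) * \<phi> (S r (S s x)))"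
    for s r
    by (simp add: F_def algebra_simps flip: exp_add)
  have F_int: "integrable (lborel \<Otimes>\<^sub>M lborel) (\<lambda>(s, r). F s r)"
  proof (rule Bochner_Integration.integrable_bound)
    show "integrable (lborel \<Otimes>\<^sub>M lborel) (\<lambda>(s, r). (norm x * B) * (p s * p r))"
      using integrable_mult_right[OF integrable_lborel_prod_mult[OF p_int p_int], of "norm x * B"]
      by (simp add: case_prod_beta')
    have "continuous_on ({0<..} \<times> {0<..})
        (\<lambda>q. exp (- l * (snd q + fst q)) * \<phi> ((\<lambda>(r, s). S r (S s x)) (snd q, fst q)))"
      by (intro continuous_intros bounded_linear.continuous_on[OF \<phi>]
          continuous_on_compose2[OF S_S_continuous]) auto
    from borel_measurable_indicator_mult[OF this]
    have "(\<lambda>q. indicator ({0<..} \<times> {0<..}) q *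
        (exp (- l * (snd q + fst q)) * \<phi> (S (snd q) (S (fst q) x)))) \<in> borel_measurable borel"
      by (simp add: borel_open open_Times)
    also have "(\<lambda>q. indicator ({0<..} \<times> {0<..}) q *
        (exp (- l * (snd q + fst q)) * \<phi> (S (snd q) (S (fst q) x)))) = (\<lambda>(s, r). F s r)"
      by (auto simp: F_def indicator_def fun_eq_iff)
    finally show "(\<lambda>(s, r). F s r) \<in> borel_measurable (lborel \<Otimes>\<^sub>M lborel)"
      by (simp add: borel_prod lborel_prod)
    have "norm (F s r) \<le> norm (norm x * B * (p s * p r))" for s r
    proof (cases "s > 0 \<and> r > 0")
      case True
      then have "norm (S r (S s x)) * B \<le> (S_bound r * S_bound s * norm x) * B"
        using B by (intro mult_right_mono norm_S_S_le) auto
      then have "\<bar>\<phi> (S r (S s x))\<bar> \<le> S_bound r * S_bound s * norm x * B"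
        using B(1)[of "S r (S s x)"] by linarith
      then have "\<bar>F s r\<bar> \<le> exp (- l * s) * (exp (- l * r) * (S_bound r * S_bound s * norm x * B))"
        using True by (simp add: F_split abs_mult)
      also have "\<dots> = norm x * B * (p s * p r)" using True by (simp add: p_def)
      finally show ?thesis by simp
    qed (auto simp: F_def)
    then show "AE q in lborel \<Otimes>\<^sub>M lborel. norm (case q of (s, r) \<Rightarrow> F s r)
        \<le> norm (case q of (s, r) \<Rightarrow> norm x * B * (p s * p r))"
      by (intro AE_I2) auto
  qed
  note conv = laplace_convolution[of l "\<lambda>r s. \<phi> (S r (S s x))", folded F_def, OF F_int]
  have eq: "laplace_integrable (\<lambda>t. \<phi> ((S \<star> S) t x)) l \<longleftrightarrow>
      laplace_integrable (\<lambda>t. \<integral>s. indicator {0<..<t} s * \<phi> (S (t - s) (S s x)) \<partial>lborel) l"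
    "laplace (\<lambda>t. \<phi> ((S \<star> S) t x)) l =
      laplace (\<lambda>t. \<integral>s. indicator {0<..<t} s * \<phi> (S (t - s) (S s x)) \<partial>lborel) l"
    by (rule laplace_cong_pos, erule functional_S_conv_S[OF \<phi>])+
  show "laplace_integrable (\<lambda>t. \<phi> ((S \<star> S) t x)) l"
    using conv(1) by (simp add: eq(1))
  have \<phi>R: "bounded_linear (\<lambda>y. \<phi> (Rs l y))"
    using bounded_linear_compose[OF \<phi> Rs_bounded_linear[OF l(1)]] .
  have "laplace (\<lambda>t. \<phi> ((S \<star> S) t x)) l = (\<integral>s. (\<integral>r. F s r \<partial>lborel) \<partial>lborel)"
    using conv(2) by (simp add: eq(2))
  also have "\<dots> = (\<integral>s. indicator {0<..} s * exp (- l * s) * laplace (\<lambda>r. \<phi> (S r (S s x))) l \<partial>lborel)"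
    unfolding F_split laplace_def integral_mult_right_zero ..
  also have "\<dots> = laplace (\<lambda>s. \<phi> (Rs l (S s x))) l"
    unfolding laplace_S[OF \<phi> l] unfolding laplace_def ..
  also have "\<dots> = \<phi> (Rs l (Rs l x))" by (rule laplace_S[OF \<phi>R l])
  finally show "laplace (\<lambda>t. \<phi> ((S \<star> S) t x)) l = \<phi> (Rs l (Rs l x))" .
qed

text \<open>The resolvent identity factors the difference quotient into that of
  \<open>l powr \<alpha>\<close> and a transform that is continuous in \<open>l\<close>, so no
  derivative of the resolvent itself has to be established.\<close>

lemma
  fixes \<phi> :: "'a \<Rightarrow> real"
  assumes \<phi>: "bounded_linear \<phi>" and l: "l > \<omega>" "l > w"
  shows laplace_integrable_mult_S: "laplace_integrable (\<lambda>t. t * \<phi> (S t x)) l"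
    and laplace_mult_S: "laplace (\<lambda>t. t * \<phi> (S t x)) l = \<alpha> * l powr (\<alpha> - 1) * \<phi> (Rs l (Rs l x))"
proof -
  \<comment> \<open>A point strictly between the abscissa bounds and \<open>l\<close>, as the
    exponential gap for the difference quotient.\<close>
  define l0 where "l0 = (l + max \<omega> w) / 2"
  have l0: "l0 > \<omega>" "l0 > w" "l0 < l" using l by (auto simp: l0_def)
  have l_pos: "l > 0" using l(1) \<omega> by simp
  note quot = laplace_difference_quotient[OF laplace_integrable_S[OF \<phi> l0(1,2), of x] l0(3)]
  show "laplace_integrable (\<lambda>t. t * \<phi> (S t x)) l" by (rule quot(1))
  define ln where "ln n = l + 1 / real (Suc n)" for n
  have ln: "ln n > \<omega>" "ln n > w" for n using l by (auto simp: ln_def intro: less_trans)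
  have \<phi>R: "bounded_linear (\<lambda>y. \<phi> (Rs l y))"
    using bounded_linear_compose[OF \<phi> Rs_bounded_linear[OF l(1)]] .
  have eq: "(laplace (\<lambda>t. \<phi> (S t x)) l - laplace (\<lambda>t. \<phi> (S t x)) (ln n)) * real (Suc n)
      = ((ln n powr \<alpha> - l powr \<alpha>) * real (Suc n)) * laplace (\<lambda>t. \<phi> (Rs l (S t x))) (ln n)" for n
  proof -
    \<comment> \<open>The identity is oriented so that the outer resolvent is \<open>Rs l\<close>:
      the functional \<open>\<phi>\<close> after \<open>Rs l\<close> then stays the same for all
      \<open>n\<close>.\<close>
    have "\<phi> (Rs (ln n) x) = \<phi> (Rs l x + (l powr \<alpha> - ln n powr \<alpha>) *\<^sub>R Rs l (Rs (ln n) x))"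
      using resolvent_identity[OF ln(1) l(1)] by (rule arg_cong)
    also have "\<dots> = \<phi> (Rs l x) + (l powr \<alpha> - ln n powr \<alpha>) * \<phi> (Rs l (Rs (ln n) x))"
      by (simp add: linear_simps[OF \<phi>])
    finally have "\<phi> (Rs l x) - \<phi> (Rs (ln n) x) = (ln n powr \<alpha> - l powr \<alpha>) * \<phi> (Rs l (Rs (ln n) x))"
      by (simp add: algebra_simps)
    then show ?thesis
      unfolding laplace_S[OF \<phi> l] laplace_S[OF \<phi> ln] laplace_S[OF \<phi>R ln]
      by (simp only: mult_ac)
  qed
  have "(\<lambda>n. (ln n powr \<alpha> - l powr \<alpha>) * real (Suc n)) \<longlonglongrightarrow> \<alpha> * l powr (\<alpha> - 1)"
    unfolding ln_def using l_pos by real_asymp (simp add: powr_diff divide_inverse)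
  moreover have "(\<lambda>n. laplace (\<lambda>t. \<phi> (Rs l (S t x))) (ln n)) \<longlonglongrightarrow> \<phi> (Rs l (Rs l x))"
    using laplace_continuous_seq[OF laplace_integrable_S[OF \<phi>R l, of x]]
    unfolding ln_def laplace_S[OF \<phi>R l] .
  ultimately have "(\<lambda>n. (laplace (\<lambda>t. \<phi> (S t x)) l - laplace (\<lambda>t. \<phi> (S t x)) (ln n)) * real (Suc n))
      \<longlonglongrightarrow> \<alpha> * l powr (\<alpha> - 1) * \<phi> (Rs l (Rs l x))"
    unfolding eq by (rule tendsto_mult)
  then show "laplace (\<lambda>t. t * \<phi> (S t x)) l = \<alpha> * l powr (\<alpha> - 1) * \<phi> (Rs l (Rs l x))"
    using quot(2) unfolding ln_def by (rule LIMSEQ_unique[rotated])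
qed

section \<open>From transforms back to the identity at time T\<close>

lemma S_dominated_upto:
  assumes "T > 0"
  obtains g where "g integrable_on {0..T}"
    "\<And>s. 0 < s \<Longrightarrow> s < T \<Longrightarrow> norm (S s x) \<le> g s \<and> norm ((S \<star> S) s x) \<le> g s"
proof -
  define N where "N = max 1 T"
  define c where "c = M * N powr (1 - \<alpha>) * exp (w * N)"
  have N: "1 \<le> N" by (simp add: N_def)
  obtain C where C: "C \<ge> 0" "\<And>t. 0 < t \<Longrightarrow> t \<le> N \<Longrightarrow> norm ((S \<star> S) t x) \<le> C * t powr (2 * \<alpha> - 1)"
    using S_conv_S_bound[OF N, of x] by blast
  have c: "c \<ge> 0" using M by (simp add: c_def)
  \<comment> \<open>Both exponents exceed -1, so one integrable function controls \<open>S\<close>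
    and \<open>S \<star> S\<close> alike.\<close>
  define g where "g s = c * norm x * s powr (\<alpha> - 1) + C * s powr (2 * \<alpha> - 1)" for s
  have "g integrable_on {0..T}"
    unfolding g_def using \<alpha> assms
    by (intro integrable_add integrable_on_mult_right integrable_on_powr_from_0) auto
  moreover have "norm (S s x) \<le> g s \<and> norm ((S \<star> S) s x) \<le> g s" if s: "0 < s" "s < T" for s
  proof
    have "S_bound s * norm x \<le> (c * s powr (\<alpha> - 1)) * norm x"
      using S_bound_le_powr[of s N] s N by (intro mult_right_mono) (auto simp: c_def N_def)
    then have "norm (S s x) \<le> c * norm x * s powr (\<alpha> - 1)"
      using norm_S_le[OF s(1), of x] by (simp add: mult_ac)
    then show "norm (S s x) \<le> g s" unfolding g_def using C(1) by (simp add: add_increasing2)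
    show "norm ((S \<star> S) s x) \<le> g s"
      unfolding g_def using C(2)[of s] s c by (simp add: N_def add_increasing)
  qed
  ultimately show thesis by (rule that)
qed

lemma
  assumes T: "T > 0"
  shows S_integrable: "(\<lambda>s. S s x) integrable_on {0..T}"
    and S_conv_S_integrable_upto: "(\<lambda>s. (S \<star> S) s x) integrable_on {0..T}"
proof -
  obtain g where g: "g integrable_on {0..T}"
    "\<And>s. 0 < s \<Longrightarrow> s < T \<Longrightarrow> norm (S s x) \<le> g s \<and> norm ((S \<star> S) s x) \<le> g s"
    using S_dominated_upto[OF T] by blast
  show "(\<lambda>s. S s x) integrable_on {0..T}"
    by (rule integrable_on_dominated_open[OF continuous_on_subset[OF S_continuous] g(1)]) (use g(2) in auto)
  show "(\<lambda>s. (S \<star> S) s x) integrable_on {0..T}"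
    by (rule integrable_on_dominated_open[OF continuous_on_subset[OF S_conv_S_continuous] g(1)])
       (use g(2) in auto)
qed

text \<open>The claim after applying \<open>Rs m\<close> and \<phi>, with \<open>A\<close> replaced
  by its effect under \<open>Rs m\<close>. Both sides are continuous in the time variable and have
  the same transform.\<close>

lemma functional_identity:
  fixes \<phi> :: "'a \<Rightarrow> real"
  assumes \<phi>: "bounded_linear \<phi>" and m: "m > \<omega>" "m > w" and T: "T > 0"
  shows "T * \<phi> (Rs m (S T x)) = \<alpha> * integral {0..T}
    (\<lambda>s. \<phi> (Rs m (S s x)) + (m powr \<alpha> * \<phi> (Rs m ((S \<star> S) s x)) - \<phi> ((S \<star> S) s x)))"
proof -
  define \<psi> where "\<psi> y = \<phi> (Rs m y)" for y
  define c where "c s = \<psi> (S s x) + (m powr \<alpha> * \<psi> ((S \<star> S) s x) - \<phi> ((S \<star> S) s x))" for s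
  \<comment> \<open>The Lebesgue integral is used here to fit \<open>laplace_integral\<close>;
    \<open>c_int\<close> converts it for the continuity argument and for the conclusion.\<close>
  define \<Phi> where "\<Phi> t = t * \<psi> (S t x) - \<alpha> * (\<integral>s. indicator {0<..<t} s * c s \<partial>lborel)" for t
  have \<psi>: "bounded_linear \<psi>"
    unfolding \<psi>_def using bounded_linear_compose[OF \<phi> Rs_bounded_linear[OF m(1)]] .
  obtain B where B: "\<And>y. \<bar>\<phi> y\<bar> \<le> norm y * B" "B > 0"
    using bounded_linear.pos_bounded[OF \<phi>] by auto
  obtain B' where B': "\<And>y. \<bar>\<psi> y\<bar> \<le> norm y * B'" "B' > 0"
    using bounded_linear.pos_bounded[OF \<psi>] by auto
  have c_cont: "continuous_on {0<..} c"
    unfolding c_def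
    by (intro continuous_intros bounded_linear.continuous_on[OF \<phi>] bounded_linear.continuous_on[OF \<psi>]
        S_continuous S_conv_S_continuous)
  have c_int: "c integrable_on {0..t} \<and> (\<integral>s. indicator {0<..<t} s * c s \<partial>lborel) = integral {0..t} c"
    if t: "t > 0" for t
  proof -
    obtain g where g: "g integrable_on {0..t}"
      "\<And>s. 0 < s \<Longrightarrow> s < t \<Longrightarrow> norm (S s x) \<le> g s \<and> norm ((S \<star> S) s x) \<le> g s"
      using S_dominated_upto[OF t] by blast
    have g': "(\<lambda>s. (B' + (m powr \<alpha> * B' + B)) * g s) integrable_on {0..t}"
      using g(1) by (rule integrable_on_mult_right)
    have le: "\<bar>c s\<bar> \<le> (B' + (m powr \<alpha> * B' + B)) * g s" if s: "0 < s" "s < t" for s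
    proof -
      have *: "\<bar>\<psi> (S s x)\<bar> \<le> B' * g s" "\<bar>\<psi> ((S \<star> S) s x)\<bar> \<le> B' * g s" "\<bar>\<phi> ((S \<star> S) s x)\<bar> \<le> B * g s"
        using g(2)[OF s] B B' by (metis (no_types) mult.commute mult_left_mono less_imp_le order_trans)+
      have "\<bar>m powr \<alpha> * \<psi> ((S \<star> S) s x)\<bar> \<le> m powr \<alpha> * (B' * g s)"
        using *(2) by (simp add: abs_mult mult_left_mono)
      then have "\<bar>c s\<bar> \<le> B' * g s + (m powr \<alpha> * (B' * g s) + B * g s)"
        unfolding c_def using *(1,3) by linarith
      then show ?thesis by (simp add: algebra_simps)
    qed
    have cc: "continuous_on {0<..<t} c" by (rule continuous_on_subset[OF c_cont]) auto
    show ?thesis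
      using integrable_on_dominated_open[OF cc g'] lborel_integral_dominated_open[OF cc g'] le by simp
  qed
  have "continuous_on {0<..} (\<lambda>t. integral {0..t} c)"
    unfolding continuous_on_eq_continuous_at[OF open_greaterThan]
  proof
    fix t :: real assume t: "t \<in> {0<..}"
    have "continuous_on {0<..<t + 1} (\<lambda>t. integral {0..t} c)"
      by (rule continuous_on_subset[OF indefinite_integral_continuous_1[of c 0 "t + 1"]])
         (use t c_int[of "t + 1"] in auto)
    then show "isCont (\<lambda>t. integral {0..t} c) t"
      using t by (simp add: continuous_on_eq_continuous_at)
  qed
  then have "continuous_on {0<..} (\<lambda>t. t * \<psi> (S t x) - \<alpha> * integral {0..t} c)"
    by (intro continuous_intros bounded_linear.continuous_on[OF \<psi>] S_continuous)
  then have \<Phi>_cont: "continuous_on {0<..} \<Phi>"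
    by (rule continuous_on_eq) (simp add: \<Phi>_def c_int)
  have \<Phi>_laplace: "laplace_integrable \<Phi> l \<and> laplace \<Phi> l = 0" if l: "l > \<omega>" "l > w" for l
  proof -
    have l_pos: "l > 0" using l(1) \<omega> by simp
    note I = laplace_integrable_S[OF \<psi> l, of x]
      laplace_integrable_S_conv_S[OF \<psi> l, of x] laplace_integrable_S_conv_S[OF \<phi> l, of x]
    note d = laplace_diff[OF laplace_cmult(1)[OF I(2), of "m powr \<alpha>"] I(3)]
    have c_lap: "laplace_integrable c l"
      unfolding c_def by (rule laplace_add(1)[OF I(1) d(1)])
    have "laplace c l = \<psi> (Rs l x) + (m powr \<alpha> * \<psi> (Rs l (Rs l x)) - \<phi> (Rs l (Rs l x)))"
      unfolding c_def laplace_add(2)[OF I(1) d(1)] d(2) laplace_cmult(2)[OF I(2)]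
        laplace_S[OF \<psi> l] laplace_S_conv_S[OF \<psi> l] laplace_S_conv_S[OF \<phi> l] ..
    \<comment> \<open>Trading the outer \<open>Rs l\<close> for \<open>Rs m\<close> expresses
      everything through \<psi>. The terms in \<open>\<psi> (Rs l x)\<close> and those with
      \<open>m powr \<alpha>\<close> then cancel.\<close>
    also have "\<phi> (Rs l (Rs l x)) = \<psi> (Rs l x) + (m powr \<alpha> - l powr \<alpha>) * \<psi> (Rs l (Rs l x))"
      by (subst resolvent_identity[OF l(1) m(1)]) (simp add: linear_simps[OF \<phi>] \<psi>_def)
    finally have c_val: "laplace c l = l powr \<alpha> * \<psi> (Rs l (Rs l x))"
      by (simp add: algebra_simps)
    note L = laplace_diff[OF laplace_integrable_mult_S[OF \<psi> l, of x]
        laplace_cmult(1)[OF laplace_integral(1)[OF c_lap l_pos], of \<alpha>]]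
    have "laplace \<Phi> l = \<alpha> * l powr (\<alpha> - 1) * \<psi> (Rs l (Rs l x)) - \<alpha> * (l powr \<alpha> * \<psi> (Rs l (Rs l x)) / l)"
      unfolding \<Phi>_def L(2) laplace_mult_S[OF \<psi> l]
        laplace_cmult(2)[OF laplace_integral(1)[OF c_lap l_pos]] laplace_integral(2)[OF c_lap l_pos] c_val ..
    also have "\<dots> = 0" using l_pos by (simp add: powr_diff)
    finally show ?thesis using L(1) by (simp add: \<Phi>_def[abs_def])
  qed
  have "\<Phi> T = 0"
    \<comment> \<open>The points \<open>m + n\<close> at which uniqueness tests the transform all
      lie beyond \<omega> and \<open>w\<close>.\<close>
    using \<Phi>_laplace m T by (intro laplace_unique[of _ m, OF _ _ \<Phi>_cont]) (auto intro: add_strict_increasing2)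
  then show ?thesis using c_int[OF T] by (simp add: \<Phi>_def c_def[abs_def] \<psi>_def)
qed

lemma mult_S_eq_G:
  assumes T: "T > 0"
  shows "(g1 \<star> S \<star> S) T x \<in> D \<and> T *\<^sub>R S T x = \<alpha> *\<^sub>R G A S T x"
proof -
  define m where "m = max \<omega> w + 1"
  have m: "m > \<omega>" "m > w" by (auto simp: m_def)
  define y where "y = integral {0..T} (\<lambda>s. (S \<star> S) s x)"
  define v where "v = integral {0..T} (\<lambda>s. S s x)"
  \<comment> \<open>The value of \<open>A y\<close> forced by the claim, found by solving
    \<open>T *\<^sub>R S T x = \<alpha> *\<^sub>R (A y + v)\<close>.\<close>
  define z where "z = (T / \<alpha>) *\<^sub>R S T x - v"
  have y_eq: "(g1 \<star> S \<star> S) T x = y" and v_eq: "(g1 \<star> S) T x = v"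
    unfolding y_def v_def by (subst op_conv_def, rule integral_gker_1)+
  have "y = Rs m ((m powr \<alpha>) *\<^sub>R y - z)"
  proof (rule ccontr)
    assume "\<not> ?thesis"
    then have "y - Rs m ((m powr \<alpha>) *\<^sub>R y - z) \<noteq> 0" by simp
    then obtain \<phi> :: "'a \<Rightarrow> real" where \<phi>: "bounded_linear \<phi>"
      and ne: "\<phi> (y - Rs m ((m powr \<alpha>) *\<^sub>R y - z)) \<noteq> 0"
      by (rule separating_functional)
    have \<phi>R: "bounded_linear (\<lambda>y. \<phi> (Rs m y))"
      using bounded_linear_compose[OF \<phi> Rs_bounded_linear[OF m(1)]] .
    note W = S_conv_S_integrable_upto[OF T, of x] and V = S_integrable[OF T, of x]
    have i: "((\<lambda>s. \<phi> (Rs m (S s x))) has_integral \<phi> (Rs m v)) {0..T}"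
      "((\<lambda>s. \<phi> (Rs m ((S \<star> S) s x))) has_integral \<phi> (Rs m y)) {0..T}"
      "((\<lambda>s. \<phi> ((S \<star> S) s x)) has_integral \<phi> y) {0..T}"
      using has_integral_linear[OF integrable_integral[OF V] \<phi>R]
        has_integral_linear[OF integrable_integral[OF W] \<phi>R]
        has_integral_linear[OF integrable_integral[OF W] \<phi>]
      by (simp_all add: o_def y_def v_def)
    have "integral {0..T} (\<lambda>s. \<phi> (Rs m (S s x))
        + (m powr \<alpha> * \<phi> (Rs m ((S \<star> S) s x)) - \<phi> ((S \<star> S) s x)))
      = \<phi> (Rs m v) + (m powr \<alpha> * \<phi> (Rs m y) - \<phi> y)"
      by (intro integral_unique has_integral_add has_integral_diff has_integral_mult_right i)
    with functional_identity[OF \<phi> m T, of x]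
    have "T / \<alpha> * \<phi> (Rs m (S T x)) = \<phi> (Rs m v) + (m powr \<alpha> * \<phi> (Rs m y) - \<phi> y)"
      using \<alpha> by (simp add: field_simps)
    then have "\<phi> (y - Rs m ((m powr \<alpha>) *\<^sub>R y - z)) = 0"
      using linear_simps[OF \<phi>R] linear_simps[OF \<phi>] by (simp add: z_def)
    with ne show False by simp
  qed
  then have y: "y \<in> D" "(m powr \<alpha>) *\<^sub>R y - A y = (m powr \<alpha>) *\<^sub>R y - z"
    using Rs_in_D[OF m(1)] Rs_right[OF m(1), of "(m powr \<alpha>) *\<^sub>R y - z"] by metis+
  then have "A y = z" by simp
  then have "\<alpha> *\<^sub>R G A S T x = T *\<^sub>R S T x"
    using \<alpha> by (simp add: G_def y_eq v_eq z_def)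
  then show ?thesis using y(1) by (simp add: y_eq)
qed

end

theorem theorem14:
  fixes \<alpha> T :: real
    and D :: "'a::complex_banach set" and A :: "'a \<Rightarrow> 'a"
    and S :: "real \<Rightarrow> 'a \<Rightarrow> 'a" and u :: "real \<Rightarrow> 'a" and x :: 'a
  assumes "0 < \<alpha>" and "\<alpha> < 1"
    and "closed_operator D A"
    and "resolvent_family \<alpha> \<alpha> D A S"
    and "\<And>t. t > 0 \<Longrightarrow> u t = S t x"
    and "T > 0"
  shows "(g1 \<star> S \<star> S) T x \<in> D \<and> T *\<^sub>R u T = \<alpha> *\<^sub>R G A S T x"
proof -
  obtain M w where M: "M > 0"
    and bound: "\<And>t. t > 0 \<Longrightarrow> onorm (S t) \<le> M * max 1 (t powr (\<alpha> - 1)) * exp (w * t)"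
    using assms(4) unfolding resolvent_family_def by blast
  obtain \<omega> where \<omega>: "\<omega> \<ge> 0"
    "{z powr complex_of_real \<alpha> | z. Re z > \<omega>} \<subseteq> resolvent_set D A"
    "\<And>x z. Re z > \<omega> \<Longrightarrow> ((\<lambda>t. exp (- z * complex_of_real t) *\<^sub>C S t x) has_integral
       (z powr complex_of_real (\<alpha> - \<alpha>)) *\<^sub>C resolvent D A (z powr complex_of_real \<alpha>) x) {0..}"
    using assms(4) unfolding resolvent_family_def by blast
  interpret alpha_resolvent_family \<alpha> D A S M "max 0 w" \<omega>
  proof
    fix t :: real assume t: "t > 0"
    have "M * max 1 (t powr (\<alpha> - 1)) * exp (w * t) \<le> M * max 1 (t powr (\<alpha> - 1)) * exp (max 0 w * t)"
      using t M by (intro mult_left_mono) (auto intro: mult_right_mono)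
    with bound[OF t] show "onorm (S t) \<le> M * max 1 (t powr (\<alpha> - 1)) * exp (max 0 w * t)"
      by (rule order_trans)
    show "bounded_clinear (S t)" using assms(4) t unfolding resolvent_family_def by blast
  next
    fix x show "continuous_on {0<..} (\<lambda>t. S t x)"
      using assms(4) unfolding resolvent_family_def by blast
  qed (use assms(1,2) M \<omega> in auto)
  show ?thesis using mult_S_eq_G[OF assms(6)] assms(5,6) by simp
qed

end
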